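(* Let $n$ be a nonnegative integer and suppose $bc=a^2q^{n+1}$ and $de=aq^{n+1}$. Then \begin{multline*} \sum_{k=0}^{\lfloor n/2 \rfloor} \frac{E(aq^{4k})}{E(a)} \frac{(b,c;q^3,p)_k}{(aq/b,aq/c;q,p)_k} \frac{(q^{-n};q,p)_{2k}}{(aq^{n+1};q,p)_{2k}} \frac{(d,e;q,p)_k}{(aq^3/d,aq^3/e;q^3,p)_k}\, q^k \\ =\frac{(aq;q,p)_n\,(aq^{2-n}/b;q^3,p)_n} {(aq/b;q,p)_n\,(aq^{2-n};q^3,p)_n} \,{_{10}\omega_9}(a^2/de;b,c,a/d,a/e,q^{2-n},q^{1-n},q^{-n};q^3,p). \end{multline*}
   Context: Let $p$ be a complex number with $|p|<1$, $q$ a nonzero complex number, and all parameters generic so that no denominator vanishes. For nonzero $x$, $E(x)=E(x;p)=\prod_{k\ge 0}(1-xp^k)(1-p^{k+1}/x)$. For a nonzero base $Q$ and integer $m$, $(a;Q,p)_m=\prod_{k=0}^{m-1}E(aQ^k)$ if $m>0$, $=1$ if $m=0$, and $=1/\prod_{k=0}^{-m-1}E(aQ^{m+k})$ if $m<0$; $(a_1,\dots,a_s;Q,p)_m=\prod_{i=1}^s(a_i;Q,p)_m$. For parameters with $(a_4\cdots a_{r+1})^2=a_1^{r-3}Q^{r-5}$ and one of $a_4,\dots,a_{r+1}$ of the form $Q^{-N}$ ($N$ a nonnegative integer), \[{_{r+1}\omega_r}(a_1;a_4,\dots,a_{r+1};Q,p)=\sum_{k\ge 0}\frac{E(a_1Q^{2k})}{E(a_1)}\frac{(a_1,a_4,\dots,a_{r+1};Q,p)_k\,Q^k}{(Q,a_1Q/a_4,\dots,a_1Q/a_{r+1};Q,p)_k}.\]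 (In the ${_{10}\omega_9}$ above, whichever of $q^{2-n},q^{1-n},q^{-n}$ is an integer power $q^{-3N}$ of the base $q^3$ makes the series terminate.) *)

theory Defs
  imports "HOL-Analysis.Analysis"
begin

definition ethe :: "complex \<Rightarrow> complex \<Rightarrow> complex" where
  "ethe p x = (\<Prod>k. (1 - x * p ^ k) * (1 - p ^ (k + 1) / x))"

definition tpoch :: "complex \<Rightarrow> complex \<Rightarrow> complex \<Rightarrow> int \<Rightarrow> complex" where
  "tpoch Q p a m =
     (if m > 0 then (\<Prod>k<nat m. ethe p (a * Q ^ k))
      else if m = 0 then 1
      else 1 / (\<Prod>k<nat (- m). ethe p (a * Q powi (m + int k))))"

definition tpochs :: "complex \<Rightarrow> complex \<Rightarrow> complex list \<Rightarrow> int \<Rightarrow> complex" where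
  "tpochs Q p as m = prod_list (map (\<lambda>a. tpoch Q p a m) as)"

text \<open>Terminating very-well-poised series  {r+1}omega_r(a1; a4,...,a_{r+1}; Q, p),
  where the list  as = [a4,...,a_{r+1}].\<close>
definition omega :: "complex \<Rightarrow> complex \<Rightarrow> complex \<Rightarrow> complex list \<Rightarrow> complex" where
  "omega Q p a1 as =
     (\<Sum>k. ethe p (a1 * Q ^ (2 * k)) / ethe p a1
           * tpochs Q p (a1 # as) (int k) * Q ^ k
           / tpochs Q p (Q # map (\<lambda>x. a1 * Q / x) as) (int k))"

end

theory Submission
  imports Defs "HOL-Library.Nat_Bijection"
begin

text \<open>
  Let \<open>f\<^sub>k(d)\<close> be the factor of the \<open>k\<close>-th term on the left that depends on \<open>d\<close> and \<open>e\<close>. As a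
  function of \<open>d\<close> with \<open>d e\<close> fixed it has simple poles, and Lagrange interpolation for theta
  functions expands it in the functions \<open>E(a/d) E(a/e) / (E(aq\<^bsup>3j\<^esup>/d) E(aq\<^bsup>3j\<^esup>/e))\<close>, which are exactly the
  factors depending on \<open>d\<close>, \<open>e\<close> on the right. After exchanging the sums, the inner sum for index \<open>j\<close>
  is the case \<open>d = a\<close> with \<open>(n, a, b, c)\<close> replaced by \<open>(n - 2j, aq\<^bsup>4j\<^esup>, bq\<^bsup>3j\<^esup>, cq\<^bsup>3j\<^esup>)\<close>, a cubic summation
  with a product on the right. That summation follows by induction from \<open>(n, a)\<close> to \<open>(n + 2, a/q)\<close>
  with \<open>b, c\<close> fixed: one instance of the addition formula splits each term in two, and another one
  recombines the pieces. The addition formula comes from the Jacobi triple product. These arguments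
  divide by theta values that the hypotheses allow to vanish, so they give the identity for generic
  parameters only; the rest is continuity.
\<close>

section \<open>The triple product and the addition formula\<close>

text \<open>Passing from (n, a) to (n + 2, a/q) leaves a^2 q^(n+1) = bc unchanged; this is why the
  induction can keep b and c and moves in steps of two. All uses of the addition formula go through
  one antisymmetric kernel \<open>ethe2 p K\<close> and its Pluecker relation. The constant K brings
  the parameters in: K = bc for splitting a term, K = de for the interpolation, and a power of q
  times a for recombining. Iterating the same relation gives the Lagrange formula algebraically,
  with no argument about poles. A product of k kernels needs k + 1 nodes, but only k of them occur
  as poles of \<open>f\<^sub>k\<close>; the extra node j = 0 is the source of the numerator E(a/d)
  E(a/e). The obstacle is genericity. The induction divides by E(q^m) and E(aq^m) for exponents m
  absent from the given denominators, so even q has to be perturbed. The free parameters are q, a,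
  b, d, since c and e follow from the two constraints. As the zeros of E form a countable set,
  generic values exist arbitrarily close to the given ones.\<close>

definition half_theta :: "complex \<Rightarrow> complex \<Rightarrow> complex" where
  "half_theta p x = (\<Prod>k. 1 - x * p ^ k)"

lemma half_theta_convergent:
  fixes p x :: complex assumes "norm p < 1"
  shows "convergent_prod (\<lambda>k. 1 - x * p ^ k)"
proof (intro abs_convergent_prod_imp_convergent_prod summable_imp_abs_convergent_prod)
  have "summable (\<lambda>k. norm x * norm p ^ k)"
    using assms by (intro summable_mult summable_geometric) auto
  then show "summable (\<lambda>k. norm (1 - x * p ^ k - 1))"
    by (simp add: norm_mult norm_power)
qed

lemma ethe_eq_half_theta:
  assumes "norm p < 1"
  shows "ethe p x = half_theta p x * half_theta p (p / x)"
proof -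
  have "half_theta p x * half_theta p (p / x)
      = (\<Prod>k. (1 - x * p ^ k) * (1 - p / x * p ^ k))"
    unfolding half_theta_def
    using assms by (intro prodinf_mult half_theta_convergent)
  then show ?thesis by (simp add: ethe_def)
qed

lemma ethe_LIMSEQ:
  assumes "norm p < 1"
  shows "(\<lambda>N. \<Prod>k<N. (1 - x * p ^ k) * (1 - p ^ (k + 1) / x)) \<longlonglongrightarrow> ethe p x"
proof -
  have "convergent_prod (\<lambda>k. (1 - x * p ^ k) * (1 - p / x * p ^ k))"
    using assms by (intro convergent_prod_mult half_theta_convergent)
  then have "(\<lambda>N. \<Prod>k\<le>N. (1 - x * p ^ k) * (1 - p ^ (k + 1) / x)) \<longlonglongrightarrow> ethe p x"
    unfolding ethe_def by (drule_tac convergent_prod_LIMSEQ) simp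
  then show ?thesis
    by (subst (asm) lessThan_Suc_atMost[symmetric]) (rule LIMSEQ_imp_Suc)
qed

lemma half_theta_LIMSEQ:
  assumes "norm p < 1"
  shows "(\<lambda>N. \<Prod>k<N. 1 - x * p ^ k) \<longlonglongrightarrow> half_theta p x"
  unfolding half_theta_def
  using convergent_prod_LIMSEQ[OF half_theta_convergent[OF assms, of x]]
  by (rule_tac LIMSEQ_imp_Suc) (simp add: lessThan_Suc_atMost)

text \<open>The partial products converge uniformly on closed discs by the Weierstrass M-test; the
  radius \<open>norm x + 1\<close> puts \<open>x\<close> in the interior.\<close>

lemma isCont_half_theta:
  assumes p: "norm p < 1"
  shows "isCont (half_theta p) x"
proof -
  define R where "R = norm x + 1"
  have "uniformly_convergent_on (cball 0 R) (\<lambda>N x. \<Prod>k<N. 1 - x * p ^ k)"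
  proof (rule uniformly_convergent_on_prod')
    have "summable (\<lambda>k. R * norm p ^ k)"
      using p by (intro summable_mult summable_geometric) auto
    then show "uniformly_convergent_on (cball 0 R) (\<lambda>N x. \<Sum>n<N. norm (1 - x * p ^ n - 1))"
      by (rule Weierstrass_m_test'[rotated])
         (auto simp: norm_mult norm_power intro!: mult_right_mono)
  qed (auto intro!: continuous_intros)
  moreover have "lim (\<lambda>N. \<Prod>k<N. 1 - y * p ^ k) = half_theta p y" for y
    using p by (intro limI half_theta_LIMSEQ)
  ultimately have "uniform_limit (cball 0 R) (\<lambda>N x. \<Prod>k<N. 1 - x * p ^ k) (half_theta p) sequentially"
    unfolding uniformly_convergent_uniform_limit_iff by simp
  then have "continuous_on (cball 0 R) (half_theta p)"
    by (rule uniform_limit_theorem[rotated]) (auto intro!: always_eventually continuous_intros)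
  then show ?thesis
    by (rule continuous_on_interior) (simp add: R_def)
qed

lemma tendsto_ethe [tendsto_intros]:
  assumes "norm p < 1" "(f \<longlongrightarrow> x) F" "x \<noteq> 0"
  shows "((\<lambda>y. ethe p (f y)) \<longlongrightarrow> ethe p x) F"
  unfolding ethe_eq_half_theta[OF assms(1)]
  by (intro tendsto_mult isCont_tendsto_compose[OF isCont_half_theta] assms tendsto_divide
        tendsto_const)

lemma ethe_eq_0D:
  assumes "norm p < 1" "ethe p x = 0"
  shows "\<exists>k::nat. x * p ^ k = 1 \<or> p / x * p ^ k = 1"
proof -
  have "half_theta p y = 0 \<Longrightarrow> \<exists>k::nat. y * p ^ k = 1" for y
    unfolding half_theta_def
    using prodinf_nonzero[OF half_theta_convergent[OF assms(1)], of y] by auto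
  then show ?thesis
    using assms(2) unfolding ethe_eq_half_theta[OF assms(1)] mult_eq_0_iff by blast
qed

lemma countable_ethe_zeros:
  assumes "norm p < 1"
  shows "countable {x. x \<noteq> 0 \<and> ethe p x = 0}"
proof (rule countable_subset)
  show "{x. x \<noteq> 0 \<and> ethe p x = 0} \<subseteq> range (\<lambda>k::nat. 1 / p ^ k) \<union> range (\<lambda>k::nat. p * p ^ k)"
  proof
    fix x assume "x \<in> {x. x \<noteq> 0 \<and> ethe p x = 0}"
    then obtain k :: nat where "x \<noteq> 0" "x * p ^ k = 1 \<or> p / x * p ^ k = 1"
      using ethe_eq_0D[OF assms] by blast
    then have "x = 1 / p ^ k \<or> x = p * p ^ k"
      \<comment> \<open>If \<open>p ^ k = 0\<close>, both alternatives read \<open>0 = 1\<close>, so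
        a vanishing power is never inverted.\<close>
      by (cases "p ^ k = 0") (auto simp: field_simps)
    then show "x \<in> range (\<lambda>k::nat. 1 / p ^ k) \<union> range (\<lambda>k::nat. p * p ^ k)" by blast
  qed
qed auto

section \<open>The Jacobi triple product, as a limit of its finite form\<close>

definition tri :: "int \<Rightarrow> int" where "tri m = m * (m - 1) div 2"

lemma two_tri: "2 * tri m = m * (m - 1)"
proof -
  have "even (m * (m - 1))" by auto
  then show ?thesis unfolding tri_def by simp
qed

lemma tri_add1: "tri (m + 1) = tri m + m"
  using two_tri[of m] two_tri[of "m + 1"] by (simp add: algebra_simps)

lemma tri_diff1: "tri (m - 1) = tri m - m + 1"
  using tri_add1[of "m - 1"] by simp

definition qfac :: "complex \<Rightarrow> nat \<Rightarrow> complex" where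
  "qfac p n = (\<Prod>i<n. 1 - p ^ Suc i)"

text \<open>The value 0 at negative arguments is the usual convention 1/(p;p)_m = 0. It makes the
  recurrence \<open>qfac_inv_diff1\<close> valid at every integer, so that no index range has to be
  tracked.\<close>

definition qfac_inv :: "complex \<Rightarrow> int \<Rightarrow> complex" where
  "qfac_inv p m = (if m < 0 then 0 else inverse (qfac p (nat m)))"

lemma power_neq_1:
  fixes p :: complex assumes "norm p < 1"
  shows "p ^ Suc i \<noteq> 1"
proof
  assume 1: "p ^ Suc i = 1"
  then have "norm p ^ Suc i = 1" by (metis norm_one norm_power)
  moreover have "norm p ^ Suc i \<le> norm p ^ 1" using assms by (intro power_decreasing) auto
  ultimately show False using assms by simp
qed

lemma qfac_inv_diff1:
  assumes "norm p < 1" "p \<noteq> 0"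
  shows "qfac_inv p (m - 1) = (1 - p powi m) * qfac_inv p m"
proof (cases "m > 0")
  case True
  then obtain j where j: "m = int (Suc j)" by (metis gr0_implies_Suc nat_0_le not_le zero_less_nat_eq nat_eq_iff2 less_imp_le)
  have "1 - p ^ Suc j \<noteq> 0" using power_neq_1[OF assms(1), of j] by (simp del: power_Suc)
  moreover have "qfac_inv p (m - 1) = inverse (qfac p j)" "qfac_inv p m = inverse (qfac p (Suc j))"
    "p powi m = p ^ Suc j"
    unfolding j qfac_inv_def by (simp_all add: nat_add_distrib power_int_add)
  ultimately show ?thesis
    by (simp add: qfac_def del: power_Suc)
next
  case False
  then show ?thesis by (cases "m = 0") (auto simp: qfac_inv_def)
qed

text \<open>Up to sign and power of p this is the Gaussian binomial coefficient "2N over N + m",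
  extended by 0 to \<open>\<bar>m\<bar> > N\<close>.\<close>

definition jcoeff :: "complex \<Rightarrow> nat \<Rightarrow> int \<Rightarrow> complex" where
  "jcoeff p N m = (- 1) powi m * p powi tri m * qfac p (2 * N)
     * qfac_inv p (int N + m) * qfac_inv p (int N - m)"

text \<open>This compares coefficients of \<open>x powi m\<close> after multiplication by (1 - x
  p^N)(1 - p^(N+1)/x).\<close>

lemma jcoeff_Suc:
  assumes p: "norm p < 1" "p \<noteq> 0"
  shows "jcoeff p (Suc N) m
    = (1 + p ^ (2 * N + 1)) * jcoeff p N m - p ^ N * jcoeff p N (m - 1) - p ^ (N + 1) * jcoeff p N (m + 1)"
proof -
  \<comment> \<open>\<open>u\<close> and \<open>v\<close> have the largest arguments that occur;
    every other inverse factorial is a polynomial multiple of one of them, so nothing that may be 0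
    is divided by.\<close>
  define u where "u = qfac_inv p (int N + m + 1)"
  define v where "v = qfac_inv p (int N - m + 1)"
  define M where "M = p powi m"
  define W where "W = p ^ N"
  have M: "M \<noteq> 0" using p by (simp add: M_def)
  have pw: "p powi (int N + m + 1) = W * M * p" "p powi (int N + m) = W * M"
      "p powi (int N - m + 1) = W / M * p" "p powi (int N - m) = W / M"
    using p by (simp_all add: power_int_add power_int_diff M_def W_def)
  have 1: "qfac_inv p (int N + m) = (1 - W * M * p) * u"
    using qfac_inv_diff1[OF p, of "int N + m + 1"] pw by (simp add: u_def)
  have 2: "qfac_inv p (int N - m) = (1 - W / M * p) * v"
    using qfac_inv_diff1[OF p, of "int N - m + 1"] pw by (simp add: v_def)
  have 3: "qfac_inv p (int N + (m - 1)) = (1 - W * M) * (1 - W * M * p) * u"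
    using qfac_inv_diff1[OF p, of "int N + m"] pw 1 by (simp add: add_diff_eq)
  have 4: "qfac_inv p (int N - (m + 1)) = (1 - W / M) * (1 - W / M * p) * v"
    using qfac_inv_diff1[OF p, of "int N - m"] pw 2 by (simp add: diff_diff_eq)
  have 5: "qfac_inv p (int N - (m - 1)) = v" "qfac_inv p (int N + (m + 1)) = u"
    by (simp_all add: u_def v_def algebra_simps)
  have 6: "qfac_inv p (int (Suc N) + m) = u" "qfac_inv p (int (Suc N) - m) = v"
    by (simp_all add: u_def v_def algebra_simps)
  have 7: "qfac p (2 * Suc N) = qfac p (2 * N) * (1 - W\<^sup>2 * p) * (1 - W\<^sup>2 * p\<^sup>2)"
    by (simp add: qfac_def W_def power_mult power2_eq_square power_mult_distrib algebra_simps)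
  have 8: "p powi tri (m - 1) = p powi tri m / M * p" "p powi tri (m + 1) = p powi tri m * M"
    using p by (simp_all add: tri_add1 tri_diff1 power_int_add power_int_diff M_def)
  have 9: "(-1 :: complex) powi (m - 1) = - ((- 1) powi m)" "(-1 :: complex) powi (m + 1) = - ((- 1) powi m)"
    by (simp_all add: power_int_add power_int_diff)
  have 10: "p ^ (2 * N + 1) = W\<^sup>2 * p" "p ^ (N + 1) = W * p"
    by (simp_all add: W_def power_mult power2_eq_square flip: power_mult_distrib power_add)
  define c where "c = (- 1) powi m * p powi tri m * qfac p (2 * N) * u * v"
  have "(1 - W\<^sup>2 * p) * (1 - W\<^sup>2 * p\<^sup>2) =
     (1 + W\<^sup>2 * p) * (1 - W * M * p) * (1 - W / M * p)
      + W * (p / M) * ((1 - W * M) * (1 - W * M * p)) + W * p * M * ((1 - W / M) * (1 - W / M * p))"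
    using M by (simp add: field_simps power2_eq_square)
  moreover have "jcoeff p (Suc N) m = c * ((1 - W\<^sup>2 * p) * (1 - W\<^sup>2 * p\<^sup>2))"
    unfolding jcoeff_def 6 7 c_def by (simp only: mult_ac)
  moreover have "jcoeff p N m = c * ((1 - W * M * p) * (1 - W / M * p))"
    unfolding jcoeff_def 1 2 c_def by (simp only: mult_ac)
  moreover have "jcoeff p N (m - 1) = - (c * (p / M) * ((1 - W * M) * (1 - W * M * p)))"
    unfolding jcoeff_def 3 5 8 9 c_def by (simp add: mult_ac)
  moreover have "jcoeff p N (m + 1) = - (c * M * ((1 - W / M) * (1 - W / M * p)))"
    unfolding jcoeff_def 4 5 8 9 c_def by (simp add: mult_ac)
  moreover have "c * ((1 + V) * R * S + W * P * A + W * p * M * B)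
     = (1 + V) * (c * (R * S)) - W * - (c * P * A) - W * p * - (c * M * B)" for V R S P A B
    by (simp add: algebra_simps)
  ultimately show ?thesis unfolding 10 W_def[symmetric] by metis
qed

text \<open>The next factor of the product shifts the index by 0, 1 or -1, which is
  \<open>jcoeff_Suc\<close>. Summation over all integers keeps the index set fixed as
  \<open>N\<close> tends to infinity.\<close>

lemma jacobi_finite:
  assumes p: "norm p < 1" "p \<noteq> 0" and x: "x \<noteq> 0"
  shows "((\<lambda>m. jcoeff p N m * x powi m) has_sum
           (\<Prod>k<N. (1 - x * p ^ k) * (1 - p ^ (k + 1) / x))) UNIV"
proof (induction N)
  case 0
  have "((\<lambda>m. jcoeff p 0 m * x powi m) has_sum 1) UNIV"
    by (rule has_sum_finite_neutralI[where B = "{0}"])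
       (auto simp: jcoeff_def qfac_inv_def qfac_def tri_def)
  then show ?case by simp
next
  case (Suc N)
  define P where "P = (\<Prod>k<N. (1 - x * p ^ k) * (1 - p ^ (k + 1) / x))"
  have IH: "((\<lambda>m. jcoeff p N m * x powi m) has_sum P) UNIV"
    using Suc.IH by (simp add: P_def)
  have "((\<lambda>m. jcoeff p N (m - 1) * x powi (m - 1)) has_sum P) UNIV"
    by (rule has_sum_reindex_bij_witness[where i = "\<lambda>m. m + 1" and j = "\<lambda>m. m - 1", THEN iffD2, OF _ _ _ _ _ refl IH]) auto
  from has_sum_cmult_right[OF this, of "p ^ N * x"]
  have 1: "((\<lambda>m. p ^ N * jcoeff p N (m - 1) * x powi m) has_sum (p ^ N * x * P)) UNIV"
    using x by (simp add: power_int_diff mult_ac)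
  have "((\<lambda>m. jcoeff p N (m + 1) * x powi (m + 1)) has_sum P) UNIV"
    by (rule has_sum_reindex_bij_witness[where i = "\<lambda>m. m - 1" and j = "\<lambda>m. m + 1", THEN iffD2, OF _ _ _ _ _ refl IH]) auto
  from has_sum_cmult_right[OF this, of "p ^ (N + 1) / x"]
  have 2: "((\<lambda>m. p ^ (N + 1) * jcoeff p N (m + 1) * x powi m) has_sum (p ^ (N + 1) / x * P)) UNIV"
    using x by (simp add: power_int_add mult_ac)
  have "((\<lambda>m. (1 + p ^ (2 * N + 1)) * (jcoeff p N m * x powi m) 
       + - (p ^ N * jcoeff p N (m - 1) * x powi m) + - (p ^ (N + 1) * jcoeff p N (m + 1) * x powi m))
     has_sum ((1 + p ^ (2 * N + 1)) * P + - (p ^ N * x * P) + - (p ^ (N + 1) / x * P))) UNIV"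
    by (intro has_sum_add has_sum_uminusI has_sum_cmult_right IH 1 2)
  moreover have "(1 + p ^ (2 * N + 1)) * P + - (p ^ N * x * P) + - (p ^ (N + 1) / x * P)
      = P * ((1 - x * p ^ N) * (1 - p ^ (N + 1) / x))"
  proof -
    have eq: "x * p ^ N * (p ^ (N + 1) / x) = p ^ (2 * N + 1)"
      using x by (simp add: mult_2 power_add)
    have "(1 + U * V) * P + - (p ^ N * x * P) + - (V * P) = P * ((1 - U) * (1 - V))"
      if "U = x * p ^ N" for U V using that by (simp add: algebra_simps)
    from this[OF refl, of "p ^ (N + 1) / x"] show ?thesis unfolding eq .
  qed
  moreover have "jcoeff p (Suc N) m * x powi m = (1 + p ^ (2 * N + 1)) * (jcoeff p N m * x powi m)
       + - (p ^ N * jcoeff p N (m - 1) * x powi m) + - (p ^ (N + 1) * jcoeff p N (m + 1) * x powi m)" for m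
    unfolding jcoeff_Suc[OF p] by (simp add: algebra_simps)
  ultimately show ?case by (simp only: P_def prod.lessThan_Suc)
qed

lemma summable_quadratic_exponent_aux:
  fixes a :: "nat \<Rightarrow> real"
  assumes r: "0 < r" "r < 1" and pos: "\<And>j. a j > 0" and rec: "\<And>j. a (Suc j) = K * r ^ j * a j"
  shows "summable a"
proof -
  have "(\<lambda>j. K * r ^ j) \<longlonglongrightarrow> K * 0"
    using r by (intro tendsto_mult tendsto_const LIMSEQ_power_zero) auto
  then have "eventually (\<lambda>j. K * r ^ j < 1/2) sequentially"
    by (intro order_tendstoD(2)) auto
  then obtain N where N: "\<And>j. j \<ge> N \<Longrightarrow> K * r ^ j < 1/2"
    by (auto simp: eventually_sequentially)
  show ?thesis
  proof (rule summable_ratio_test[where c = "1/2" and N = N])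
    fix j assume "N \<le> j"
    then show "norm (a (Suc j)) \<le> 1 / 2 * norm (a j)"
      using N[of j] pos[of j] pos[of "Suc j"] unfolding real_norm_def
      by (simp add: rec mult_right_mono)
  qed simp
qed

lemma summable_quadratic_exponent:
  fixes r s :: real
  assumes r: "0 < r" "r < 1" and s: "0 < s"
  shows "(\<lambda>m::int. r powi tri m * s powi m) summable_on UNIV"
proof -
  have "(\<lambda>m::int. r powi tri m * s powi m) summable_on ({0..} \<union> {..-1})"
  proof (rule summable_on_Un_disjoint)
    have "summable (\<lambda>j::nat. r powi tri (int j) * s powi int j)"
    proof (rule summable_quadratic_exponent_aux[OF r])
      fix j
      have "tri (int (Suc j)) = tri (int j) + int j" using tri_add1[of "int j"] by (simp add: add.commute)
      then show "r powi tri (int (Suc j)) * s powi int (Suc j) = s * r ^ j * (r powi tri (int j) * s powi int j)"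
        using r s by (simp add: power_int_add del: of_nat_Suc)
    qed (use r s in simp)
    then have "(\<lambda>j::nat. r powi tri (int j) * s powi int j) summable_on UNIV"
      by (subst summable_on_UNIV_nonneg_real_iff) (use r s in auto)
    then show "(\<lambda>m::int. r powi tri m * s powi m) summable_on {0..}"
      by (rule summable_on_reindex_bij_witness[where i = nat and j = int, THEN iffD1, rotated -1]) auto
    \<comment> \<open>Along -1, -2, ... the exponent \<open>tri\<close> again grows quadratically;
      consecutive terms have ratio r^(j+2)/s.\<close>
    have "summable (\<lambda>j::nat. r powi tri (- 1 - int j) * s powi (- 1 - int j))"
    proof (rule summable_quadratic_exponent_aux[OF r])
      fix j
      have "tri (- 1 - int (Suc j)) = tri (-1 - int j) + 2 + int j"
        using tri_diff1[of "-1 - int j"] by (simp add: algebra_simps)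
      moreover have "s powi (- 1 - int (Suc j)) = s powi (- 1 - int j) / s"
        using s power_int_diff[of s "-1 - int j" 1] by (simp add: algebra_simps)
      ultimately show "r powi tri (- 1 - int (Suc j)) * s powi (- 1 - int (Suc j))
          = (r\<^sup>2 / s) * r ^ j * (r powi tri (- 1 - int j) * s powi (- 1 - int j))"
        using r s by (simp add: power_int_add del: of_nat_Suc)
    qed (use r s in simp)
    then have "(\<lambda>j::nat. r powi tri (- 1 - int j) * s powi (- 1 - int j)) summable_on UNIV"
      by (subst summable_on_UNIV_nonneg_real_iff) (use r s in auto)
    then show "(\<lambda>m::int. r powi tri m * s powi m) summable_on {..-1}"
      by (rule summable_on_reindex_bij_witness[where i = "\<lambda>m. nat (- 1 - m)" and j = "\<lambda>j. - 1 - int j", THEN iffD1, rotated -1]) auto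
  qed auto
  also have "{0..} \<union> {..-1::int} = UNIV" by auto
  finally show ?thesis .
qed

lemma abs_summable_quadratic_exponent:
  fixes p x :: complex
  assumes "norm p < 1" "p \<noteq> 0" "x \<noteq> 0"
  shows "(\<lambda>m::int. norm (p powi tri m * x powi m)) summable_on UNIV"
  using summable_quadratic_exponent[of "norm p" "norm x"] assms
  by (simp add: norm_mult norm_power_int)

lemma qfac_convergent:
  assumes "norm p < 1"
  obtains L where "L \<noteq> 0" "qfac p \<longlonglongrightarrow> L"
proof -
  have conv: "convergent_prod (\<lambda>k. 1 - p * p ^ k)" using assms by (rule half_theta_convergent)
  have "(\<lambda>n. \<Prod>k\<le>n. 1 - p * p ^ k) \<longlonglongrightarrow> half_theta p p"
    unfolding half_theta_def using convergent_prod_LIMSEQ[OF conv] .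
  then have "qfac p \<longlonglongrightarrow> half_theta p p"
    unfolding qfac_def by (rule_tac LIMSEQ_imp_Suc) (simp add: lessThan_Suc_atMost)
  moreover have "half_theta p p \<noteq> 0"
    unfolding half_theta_def using conv power_neq_1[OF assms] by (intro prodinf_nonzero) auto
  ultimately show thesis using that by blast
qed

definition theta_series :: "complex \<Rightarrow> complex \<Rightarrow> complex" where
  "theta_series p x = (\<Sum>\<^sub>\<infinity>m::int. p powi tri m * (- x) powi m)"

text \<open>As \<open>N\<close> tends to infinity the Gaussian binomials tend to
  1/(p;p)_\<infinity>, which is the constant \<open>C\<close>. Tannery's theorem allows the limit
  inside the sum.\<close>

lemma ethe_eq_theta_series:
  assumes p: "norm p < 1" "p \<noteq> 0"
  obtains C where "\<And>x. x \<noteq> 0 \<Longrightarrow> ethe p x = C * theta_series p x"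
proof -
  obtain L where L: "L \<noteq> 0" "qfac p \<longlonglongrightarrow> L" using qfac_convergent[OF p(1)] .
  have inv_lim: "(\<lambda>n. inverse (qfac p n)) \<longlonglongrightarrow> inverse L" using L by (intro tendsto_inverse)
  obtain B1 where B1: "\<And>n. norm (qfac p n) \<le> B1" "B1 > 0"
    using L(2) by (metis Bseq_def convergentI convergent_imp_Bseq)
  obtain B2 where B2: "\<And>n. norm (inverse (qfac p n)) \<le> B2" "B2 > 0"
    using inv_lim by (metis (no_types, lifting) Bseq_def convergentI convergent_imp_Bseq)
  have qb: "norm (qfac_inv p m) \<le> B2" for m
    using B2(1)[of "nat m"] B2(2) by (auto simp: qfac_inv_def)
  have qlim: "(\<lambda>N. qfac_inv p (int N + m)) \<longlonglongrightarrow> inverse L" for m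
  proof -
    have "filterlim (\<lambda>N. nat (int N + m)) at_top sequentially"
      unfolding filterlim_at_top
    proof
      fix Z show "\<forall>\<^sub>F x in sequentially. Z \<le> nat (int x + m)"
        using eventually_ge_at_top[of "nat (int Z - m)"] by eventually_elim auto
    qed
    then have "(\<lambda>N. inverse (qfac p (nat (int N + m)))) \<longlonglongrightarrow> inverse L"
      by (rule filterlim_compose[OF inv_lim])
    moreover have "eventually (\<lambda>N. inverse (qfac p (nat (int N + m))) = qfac_inv p (int N + m)) sequentially"
      using eventually_ge_at_top[of "nat (- m)"] by eventually_elim (auto simp: qfac_inv_def)
    ultimately show ?thesis by (rule Lim_transform_eventually)
  qed
  have "ethe p x = inverse L * theta_series p x" if x: "x \<noteq> 0" for x
  proof -
    define t where "t = (\<lambda>m. p powi tri m * (- x) powi m)"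
    have t: "(\<lambda>m. norm (t m)) summable_on UNIV"
      unfolding t_def using abs_summable_quadratic_exponent[OF p, of "-x"] x by simp
    have nat_sums: "(\<lambda>k. f (int_decode k)) sums S" if "(f has_sum S) UNIV" for f S
      using has_sum_imp_sums has_sum_reindex_bij_betw[OF bij_int_decode] that by blast
    \<comment> \<open>Tannery's theorem concerns series over the naturals, so the integers are
      enumerated by \<open>int_decode\<close>.\<close>
    define a where "a = (\<lambda>k N. jcoeff p N (int_decode k) * x powi int_decode k)"
    have a_eq: "a k N = t (int_decode k) * (qfac p (2 * N) *
          (qfac_inv p (int N + int_decode k) * qfac_inv p (int N + - int_decode k)))" for k N
      using power_int_mult_distrib[of "-1" x "int_decode k"] by (simp add: a_def t_def jcoeff_def)
    have lim: "(\<lambda>N. a k N) \<longlonglongrightarrow> t (int_decode k) * (L * (inverse L * inverse L))" for k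
      unfolding a_eq
    proof (intro tendsto_mult tendsto_const qlim)
      show "(\<lambda>N. qfac p (2 * N)) \<longlonglongrightarrow> L"
        using L(2) by (rule filterlim_compose) (auto intro!: mult_nat_left_at_top)
    qed
    \<comment> \<open>The Gaussian binomials are bounded uniformly in both indices because
      \<open>qfac p\<close> has a nonzero limit; the quadratic exponent then dominates.\<close>
    have bound: "norm (a k N) \<le> (B1 * B2 * B2) * norm (t (int_decode k))" for k N
    proof -
      have "norm (qfac p (2 * N) * (qfac_inv p (int N + int_decode k) * qfac_inv p (int N + - int_decode k))) \<le> B1 * (B2 * B2)"
        unfolding norm_mult using B1 B2 qb by (intro mult_mono) auto
      from mult_right_mono[OF this, of "norm (t (int_decode k))"] show ?thesis
        by (simp add: a_eq norm_mult mult_ac)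
    qed
    have "(\<lambda>N. suminf (\<lambda>k. a k N)) \<longlonglongrightarrow> suminf (\<lambda>k. t (int_decode k) * (L * (inverse L * inverse L)))"
    proof (rule tannerys_theorem[THEN conjunct2, THEN conjunct2])
      show "summable (\<lambda>k. (B1 * B2 * B2) * norm (t (int_decode k)))"
        using nat_sums[OF has_sum_infsum[OF t]] by (intro summable_mult) (rule sums_summable)
    qed (use lim bound in \<open>auto intro!: always_eventually\<close>)
    moreover have "suminf (\<lambda>k. a k N) = (\<Prod>k<N. (1 - x * p ^ k) * (1 - p ^ (k + 1) / x))" for N
      unfolding a_def using sums_unique[OF nat_sums[OF jacobi_finite[OF p x, of N]]] by simp
    ultimately have "ethe p x = suminf (\<lambda>k. t (int_decode k) * (L * (inverse L * inverse L)))"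
      using ethe_LIMSEQ[OF p(1), of x] by (simp add: LIMSEQ_unique)
    also have "\<dots> = theta_series p x * (L * (inverse L * inverse L))"
      unfolding theta_series_def t_def[symmetric]
      by (rule sums_unique[OF sums_mult2[OF nat_sums[OF has_sum_infsum[OF abs_summable_summable[OF t]]]], symmetric])
    also have "\<dots> = inverse L * theta_series p x" using L by simp
    finally show ?thesis .
  qed
  then show thesis using that by blast
qed

section \<open>The product E(xy) E(x/y) has rank two\<close>

lemma has_sum_product:
  fixes f :: "'a \<Rightarrow> complex" and g :: "'b \<Rightarrow> complex"
  assumes f: "(\<lambda>x. norm (f x)) summable_on A" and g: "(\<lambda>x. norm (g x)) summable_on B"
  shows "((\<lambda>(x, y). f x * g y) has_sum (infsum f A * infsum g B)) (A \<times> B)"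
proof (rule has_sum_SigmaI[where g = "\<lambda>x. f x * infsum g B"])
  have "(\<lambda>z. norm ((\<lambda>(x, y). f x * g y) z)) summable_on A \<times> B"
  proof (intro Infinite_Sum.abs_summable_on_Sigma_iff[THEN iffD2] conjI ballI)
    show "(\<lambda>y. norm (case (x, y) of (x, y) \<Rightarrow> f x * g y)) summable_on B" for x
      using summable_on_cmult_right[OF g, of "norm (f x)"] by (simp add: norm_mult)
    have nonneg: "0 \<le> (\<Sum>\<^sub>\<infinity>y\<in>B. norm (g y))" by (intro infsum_nonneg) auto
    have "norm (\<Sum>\<^sub>\<infinity>y\<in>B. norm (case (x, y) of (x, y) \<Rightarrow> f x * g y)) = norm (f x) * (\<Sum>\<^sub>\<infinity>y\<in>B. norm (g y))" for x
      unfolding prod.case norm_mult infsum_cmult_right' using nonneg by simp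
    then show "(\<lambda>x. norm (\<Sum>\<^sub>\<infinity>y\<in>B. norm (case (x, y) of (x, y) \<Rightarrow> f x * g y))) summable_on A"
      using summable_on_cmult_left[OF f, of "\<Sum>\<^sub>\<infinity>y\<in>B. norm (g y)"] by presburger
  qed
  then show "(\<lambda>(x, y). f x * g y) summable_on A \<times> B" by (rule abs_summable_summable)
  show "((\<lambda>x. f x * infsum g B) has_sum infsum f A * infsum g B) A"
    by (rule has_sum_cmult_left[OF has_sum_infsum[OF abs_summable_summable[OF f]]])
  fix x show "((\<lambda>y. case (x, y) of (x, y) \<Rightarrow> f x * g y) has_sum f x * infsum g B) B"
    unfolding prod.case
    by (rule has_sum_cmult_right[OF has_sum_infsum[OF abs_summable_summable[OF g]]])
qed

text \<open>In the double series of E(xy) E(x/y) the index pairs (m, l) are sorted by the parity of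
  m + l. On each class the half sum u and half difference v are independent integers and the summand
  factors into a part in x, u and a part in y, v. The two classes give the two summands.\<close>

lemma ethe_product_rank_two:
  assumes p: "norm p < 1"
  obtains A B C D :: "complex \<Rightarrow> complex" where
    "\<And>x y. x \<noteq> 0 \<Longrightarrow> y \<noteq> 0 \<Longrightarrow> ethe p (x * y) * ethe p (x / y) = A x * B y + C x * D y"
proof (cases "p = 0")
  case True
  \<comment> \<open>The series needs \<open>p \<noteq> 0\<close>. For \<open>p = 0\<close> the
    product is (1 - xy)(1 - x/y) = (1 + x^2) - x(y + 1/y), already of rank two.\<close>
  have e: "ethe 0 x = 1 - x" for x
  proof -
    have "(\<lambda>k. (1 - x * 0 ^ k) * (1 - 0 ^ (k + 1) / x)) = (\<lambda>k. if k = 0 then 1 - x else 1)"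
      by (auto simp: fun_eq_iff)
    then show ?thesis unfolding ethe_def
      by (subst prodinf_finite[of "{0}"]) auto
  qed
  show thesis
    by (rule that[of "\<lambda>x. 1 + x\<^sup>2" "\<lambda>y. 1" "\<lambda>x. - x" "\<lambda>y. y + 1 / y"])
       (simp add: True e field_simps power2_eq_square)
next
  case False
  obtain C where C: "\<And>x. x \<noteq> 0 \<Longrightarrow> ethe p x = C * theta_series p x"
    using ethe_eq_theta_series[OF p False] by blast
  define S where "S = (\<lambda>x. \<Sum>\<^sub>\<infinity>m::int. (p\<^sup>2) powi tri m * x powi m)"
  have p2: "norm (p\<^sup>2) < 1" "p\<^sup>2 \<noteq> 0"
    using p False by (auto simp: norm_power power_less_one_iff)
  note summ2 = abs_summable_quadratic_exponent[OF p2]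
  have prod: "theta_series p (x * y) * theta_series p (x / y)
      = S (x\<^sup>2) * S (p * y\<^sup>2) + (- x * S (p * x\<^sup>2)) * (y * S (p\<^sup>2 * y\<^sup>2))"
    if x: "x \<noteq> 0" and y: "y \<noteq> 0" for x y
  proof -
    define f where "f = (\<lambda>(m, l). (p powi tri m * (- (x * y)) powi m) * (p powi tri l * (- (x / y)) powi l))"
    have f: "(f has_sum (theta_series p (x * y) * theta_series p (x / y))) UNIV"
      unfolding f_def theta_series_def
      using has_sum_product[OF abs_summable_quadratic_exponent[OF p False, of "- (x * y)"]
          abs_summable_quadratic_exponent[OF p False, of "- (x / y)"]] x y by simp
    let ?E = "{(m, l). even (m + l)} :: (int \<times> int) set" and ?O = "{(m, l). odd (m + l)} :: (int \<times> int) set"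
    \<comment> \<open>Here the cross terms in u and v cancel, which separates the variables. The
      identities are doubled first to avoid the \<open>div\<close> in \<open>tri\<close>.\<close>
    have "2 * tri (u + v) + 2 * tri (u - v) = 2 * (2 * tri u + 2 * tri v + v)"
       "2 * tri (u + v + 1) + 2 * tri (u - v) = 2 * (2 * tri u + u + 2 * tri v + 2 * v)" for u v
      using two_tri[of u] two_tri[of v] two_tri[of "u + v"] two_tri[of "u + v + 1"] two_tri[of "u - v"]
      by (auto simp: algebra_simps)
    then have sq: "tri (u + v) + tri (u - v) = 2 * tri u + 2 * tri v + v"
       "tri (u + v + 1) + tri (u - v) = 2 * tri u + u + 2 * tri v + 2 * v" for u v
      by (smt (verit))+
    have e1: "((p\<^sup>2) powi tri u * (x\<^sup>2) powi u) * ((p\<^sup>2) powi tri v * (p * y\<^sup>2) powi v) = f (u + v, u - v)" for u v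
    proof -
      have "p powi tri (u + v) * p powi tri (u - v) = p powi (2 * tri u) * p powi (2 * tri v) * p powi v"
        using sq(1)[of u v] False by (simp flip: power_int_add)
      moreover have "(- (x * y)) powi (u + v) * (- (x / y)) powi (u - v) = x powi (2 * u) * y powi (2 * v)"
      proof -
        have "(- (x * y)) powi (u + v) * (- (x / y)) powi (u - v)
           = ((- 1) powi (u + v) * (- 1) powi (u - v)) * (x powi (u + v) * x powi (u - v)) * (y powi (u + v) / y powi (u - v))"
          using power_int_mult_distrib[of "-1" "x * y"] power_int_mult_distrib[of "-1" "x / y"]
          by (simp add: power_int_mult_distrib power_int_divide_distrib)
        also have "(- 1 :: complex) powi (u + v) * (- 1) powi (u - v) = 1"
          by (simp flip: power_int_add)
        also have "x powi (u + v) * x powi (u - v) = x powi (2 * u)"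
          using x by (simp flip: power_int_add)
        also have "y powi (u + v) / y powi (u - v) = y powi (2 * v)"
          using y by (simp flip: power_int_diff)
        finally show ?thesis by simp
      qed
      ultimately show ?thesis
        by (simp add: f_def power_int_mult_distrib power_int_mult mult_ac power2_eq_square)
    qed
    have e2: "- x * y * (((p\<^sup>2) powi tri u * (p * x\<^sup>2) powi u) * ((p\<^sup>2) powi tri v * (p\<^sup>2 * y\<^sup>2) powi v)) = f (u + v + 1, u - v)" for u v
    proof -
      have "p powi tri (u + v + 1) * p powi tri (u - v) = p powi (2 * tri u) * p powi u * p powi (2 * tri v) * p powi (2 * v)"
        using sq(2)[of u v] False by (simp flip: power_int_add)
      moreover have "(- (x * y)) powi (u + v + 1) * (- (x / y)) powi (u - v) = - (x * x powi (2 * u)) * (y * y powi (2 * v))"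
      proof -
        have "(- (x * y)) powi (u + v + 1) * (- (x / y)) powi (u - v)
           = ((- 1) powi (u + v + 1) * (- 1) powi (u - v)) * (x powi (u + v + 1) * x powi (u - v)) * (y powi (u + v + 1) / y powi (u - v))"
          using power_int_mult_distrib[of "-1" "x * y"] power_int_mult_distrib[of "-1" "x / y"]
          by (simp add: power_int_mult_distrib power_int_divide_distrib)
        also have "(- 1 :: complex) powi (u + v + 1) * (- 1) powi (u - v) = - 1"
          by (simp flip: power_int_add)
        also have "x powi (u + v + 1) * x powi (u - v) = x * x powi (2 * u)"
          using x by (simp add: power_int_add power_int_diff power_int_mult power2_eq_square power_int_mult_distrib)
        also have "y powi (u + v + 1) / y powi (u - v) = y * y powi (2 * v)"
          using y by (simp flip: power_int_diff power_int_add_1')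
        finally show ?thesis by simp
      qed
      ultimately show ?thesis
        by (simp add: f_def power_int_mult_distrib power_int_mult mult_ac power2_eq_square)
    qed
    have E: "(f has_sum (S (x\<^sup>2) * S (p * y\<^sup>2))) ?E"
    proof -
      have "((\<lambda>(u, v). ((p\<^sup>2) powi tri u * (x\<^sup>2) powi u) * ((p\<^sup>2) powi tri v * (p * y\<^sup>2) powi v))
         has_sum (S (x\<^sup>2) * S (p * y\<^sup>2))) (UNIV \<times> UNIV)"
        unfolding S_def using x y False by (intro has_sum_product summ2) auto
      then show ?thesis
        by (rule has_sum_reindex_bij_witness[where i = "\<lambda>(m, l). ((m + l) div 2, (m - l) div 2)"
              and j = "\<lambda>(u, v). (u + v, u - v)", THEN iffD1, rotated -1])
           (auto simp: e1, presburger+)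
    qed
    have O: "(f has_sum (- x * y * (S (p * x\<^sup>2) * S (p\<^sup>2 * y\<^sup>2)))) ?O"
    proof -
      have "((\<lambda>z. - x * y * (case z of (u, v) \<Rightarrow> ((p\<^sup>2) powi tri u * (p * x\<^sup>2) powi u) * ((p\<^sup>2) powi tri v * (p\<^sup>2 * y\<^sup>2) powi v)))
         has_sum (- x * y * (S (p * x\<^sup>2) * S (p\<^sup>2 * y\<^sup>2)))) (UNIV \<times> UNIV)"
        unfolding S_def using x y False by (intro has_sum_cmult_right has_sum_product summ2) auto
      then show ?thesis
        by (rule has_sum_reindex_bij_witness[where i = "\<lambda>(m, l). ((m + l - 1) div 2, (m - l - 1) div 2)"
              and j = "\<lambda>(u, v). (u + v + 1, u - v)", THEN iffD1, rotated -1])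
           (use e2 in auto, presburger+)
    qed
    have "(f has_sum (S (x\<^sup>2) * S (p * y\<^sup>2) + - x * y * (S (p * x\<^sup>2) * S (p\<^sup>2 * y\<^sup>2)))) (?E \<union> ?O)"
      using E O by (rule has_sum_Un_disjoint) auto
    moreover have "?E \<union> ?O = UNIV" by auto
    ultimately show ?thesis using f has_sum_unique by (fastforce simp: mult_ac)
  qed
  show thesis
  proof (rule that[of "\<lambda>x. C * S (x\<^sup>2)" "\<lambda>y. C * S (p * y\<^sup>2)" "\<lambda>x. C * (- x * S (p * x\<^sup>2))" "\<lambda>y. C * (y * S (p\<^sup>2 * y\<^sup>2))"])
    fix x y :: complex assume xy: "x \<noteq> 0" "y \<noteq> 0"
    then have "ethe p (x * y) * ethe p (x / y) = C * C * (theta_series p (x * y) * theta_series p (x / y))"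
      using C[of "x * y"] C[of "x / y"] by simp
    then show "ethe p (x * y) * ethe p (x / y) =
           C * S (x\<^sup>2) * (C * S (p * y\<^sup>2)) + C * (- x * S (p * x\<^sup>2)) * (C * (y * S (p\<^sup>2 * y\<^sup>2)))"
      unfolding prod[OF xy] by (simp add: algebra_simps)
  qed
qed

section \<open>Reflection and the addition formula\<close>

lemma half_theta_shift:
  assumes p: "norm p < 1"
  shows "half_theta p x = (1 - x) * half_theta p (p * x)"
proof -
  have "(\<lambda>N. \<Prod>k<Suc N. 1 - x * p ^ k) = (\<lambda>N. (1 - x) * (\<Prod>k<N. 1 - p * x * p ^ k))"
    by (simp add: prod.lessThan_Suc_shift mult_ac del: prod.lessThan_Suc)
  moreover have "(\<lambda>N. \<Prod>k<Suc N. 1 - x * p ^ k) \<longlonglongrightarrow> half_theta p x"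
    using half_theta_LIMSEQ[OF p] by (rule LIMSEQ_Suc)
  moreover have "(\<lambda>N. (1 - x) * (\<Prod>k<N. 1 - p * x * p ^ k)) \<longlonglongrightarrow> (1 - x) * half_theta p (p * x)"
    by (intro tendsto_mult tendsto_const half_theta_LIMSEQ p)
  ultimately show ?thesis by (metis LIMSEQ_unique)
qed

lemma ethe_inverse:
  assumes p: "norm p < 1" and x: "x \<noteq> 0"
  shows "ethe p (1 / x) = - ethe p x / x"
proof -
  have "ethe p (1 / x) = (1 - 1 / x) * (half_theta p (p / x) * half_theta p (p * x))"
    using half_theta_shift[OF p, of "1 / x"] by (simp add: ethe_eq_half_theta[OF p])
  moreover have "ethe p x = (1 - x) * (half_theta p (p / x) * half_theta p (p * x))"
    using half_theta_shift[OF p, of x] by (simp add: ethe_eq_half_theta[OF p])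
  moreover have "(1 - 1 / x) * h = - ((1 - x) * h) / x" for h
    using x by (simp add: field_simps)
  ultimately show ?thesis by simp
qed

lemma ethe_1:
  assumes "norm p < 1"
  shows "ethe p 1 = 0"
  using half_theta_shift[OF assms, of 1] by (simp add: ethe_eq_half_theta[OF assms])

text \<open>The factor 1/t turns the reflection formula into antisymmetry. With r^2 = K the
  numerator is E(xy) E(x/y) at x = rt, y = rs; using K instead of r keeps square roots out of the
  applications.\<close>

definition ethe2 :: "complex \<Rightarrow> complex \<Rightarrow> complex \<Rightarrow> complex \<Rightarrow> complex" where
  "ethe2 p K t s = ethe p (K * t * s) * ethe p (t / s) / t"

lemma ethe2_antisym:
  assumes "norm p < 1" "t \<noteq> 0" "s \<noteq> 0"
  shows "ethe2 p K s t = - ethe2 p K t s"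
proof -
  have "ethe p (s / t) = - ethe p (t / s) / (t / s)"
    using ethe_inverse[OF assms(1), of "t / s"] assms by simp
  then show ?thesis
    using assms by (simp add: ethe2_def mult_ac)
qed

text \<open>
  Up to the factor \<open>1 / t\<close>, \<open>ethe2 p K\<close> has rank two by the Jacobi triple product, so its
  \<open>3 \<times> 3\<close> minors vanish. For an antisymmetric matrix the minor with rows \<open>1, 2, 3\<close> and columns
  \<open>1, 2, 4\<close> is the \<open>(1, 2)\<close> entry times the Pfaffian.
\<close>

lemma antisymmetric_rank_two_pluecker:
  fixes T :: "'a \<Rightarrow> 'a \<Rightarrow> 'b :: field"
  assumes anti: "\<And>x y. x \<in> X \<Longrightarrow> y \<in> X \<Longrightarrow> T y x = - T x y"
    and diag: "\<And>x. x \<in> X \<Longrightarrow> T x x = 0"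
    and rank: "\<And>x y. x \<in> X \<Longrightarrow> y \<in> X \<Longrightarrow> T x y = A x * B y + C x * D y"
    and X: "x \<in> X" "y \<in> X" "u \<in> X" "v \<in> X"
  shows "T x y * T u v = T x u * T y v - T x v * T y u"
proof -
  define Pf where "Pf = (\<lambda>x y u v. T x y * T u v - T x u * T y v + T x v * T y u)"
  have minor: "T x y * Pf x y u v = 0"
    if "x \<in> X" "y \<in> X" "u \<in> X" "v \<in> X" for x y u v
  proof -
    have "T x x * (T y y * T u v - T y v * T u y) - T x y * (T y x * T u v - T y v * T u x)
        + T x v * (T y x * T u y - T y y * T u x) = 0"
      using that by (simp add: rank algebra_simps)
    then show ?thesis
      using that anti[of x y] anti[of x u] anti[of y u] diag
      by (simp add: Pf_def algebra_simps)
  qed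
  \<comment> \<open>Up to sign the Pfaffian does not depend on the order of the four points, so any
    nonzero entry in the row of \<open>x\<close> can be cancelled. If there is none, both sides are
    0.\<close>
  consider "T x y \<noteq> 0" | "T x u \<noteq> 0" | "T x v \<noteq> 0" | "T x y = 0" "T x u = 0" "T x v = 0" by blast
  then show ?thesis
  proof cases
    case 1
    then have "Pf x y u v = 0" using minor[OF X] by simp
    then show ?thesis by (simp add: Pf_def algebra_simps)
  next
    case 2
    then have "Pf x u y v = 0" using minor[OF X(1,3,2,4)] by simp
    then show ?thesis using anti[OF X(2,3)] by (simp add: Pf_def algebra_simps)
  next
    case 3
    then have "Pf x v u y = 0" using minor[OF X(1,4,3,2)] by simp
    then show ?thesis
      using anti[OF X(2,3)] anti[OF X(3,4)] anti[OF X(2,4)] by (simp add: Pf_def algebra_simps)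
  next
    case 4 then show ?thesis by simp
  qed
qed

text \<open>This is the three-term addition formula of Weierstrass.\<close>

lemma ethe2_pluecker:
  assumes p: "norm p < 1" and K: "K \<noteq> 0" and nz: "x \<noteq> 0" "y \<noteq> 0" "u \<noteq> 0" "v \<noteq> 0"
  shows "ethe2 p K x y * ethe2 p K u v = ethe2 p K x u * ethe2 p K y v - ethe2 p K x v * ethe2 p K y u"
proof -
  obtain A B C D where rank: "\<And>x y. x \<noteq> 0 \<Longrightarrow> y \<noteq> 0 \<Longrightarrow>
      ethe p (x * y) * ethe p (x / y) = A x * B y + C x * D y"
    using ethe_product_rank_two[OF p] by blast
  define r where "r = csqrt K"
  have r: "r \<noteq> 0" "K = r * r" using K by (auto simp: r_def simp flip: power2_eq_square)
  show ?thesis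
  proof (rule antisymmetric_rank_two_pluecker[where X = "- {0}" and T = "ethe2 p K"])
    show "ethe2 p K x y = A (r * x) / x * B (r * y) + C (r * x) / x * D (r * y)"
      if "x \<in> - {0}" "y \<in> - {0}" for x y
      using rank[of "r * x" "r * y"] that r
      by (simp add: ethe2_def mult_ac add_divide_distrib[symmetric])
    show "ethe2 p K y x = - ethe2 p K x y" if "x \<in> - {0}" "y \<in> - {0}" for x y
      using that by (intro ethe2_antisym[OF p]) auto
  qed (use nz in \<open>auto simp: ethe2_def ethe_1[OF p]\<close>)
qed

section \<open>Theta functions at powers of the base\<close>

locale theta_base =
  fixes p q :: complex
  assumes p: "norm p < 1" and q: "q \<noteq> 0"
begin

lemma powi_numeral_mult: "q powi (numeral w * int k) = (q ^ k) ^ numeral w"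
  by (subst mult.commute) (simp add: power_int_mult)

lemmas powi_expand = power_int_add power_int_diff powi_numeral_mult q

definition th :: "complex \<Rightarrow> int \<Rightarrow> complex" where
  "th x i = ethe p (x * q powi i)"

text \<open>In the usual notation, (x q^l; q^s, p)_k. With the power of q kept apart from x, both
  bases and all parameter shifts become integer arithmetic on the offset.\<close>

definition poch :: "complex \<Rightarrow> int \<Rightarrow> int \<Rightarrow> nat \<Rightarrow> complex" where
  "poch x l s k = (\<Prod>i<k. th x (l + s * int i))"

lemma th_divide_q: "th (x / q) i = th x (i - 1)"
  using q by (simp add: th_def power_int_diff)

lemma th_divide_q': "th (x / q / y) i = th (x / y) (i - 1)"
  using th_divide_q[of "x / y"] by (simp add: divide_divide_eq_left mult.commute)

lemma poch_divide_q: "poch (x / q) l s k = poch x (l - 1) s k"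
  unfolding poch_def th_divide_q by (simp add: algebra_simps)

lemma poch_divide_q': "poch (x / q / y) l s k = poch (x / y) (l - 1) s k"
  unfolding poch_def th_divide_q' by (simp add: algebra_simps)

lemma th_shift: "th (x * q powi j) i = th x (i + j)"
  using q by (simp add: th_def power_int_add mult_ac)

lemma th_1_0: "th 1 0 = 0"
  using ethe_1[OF p] by (simp add: th_def)

lemma th_reflect:
  assumes "x \<noteq> 0"
  shows "th (1 / x) i = - (q powi i / x) * th x (- i)"
  using ethe_inverse[OF p, of "x * q powi (- i)"] assms q
  by (simp add: th_def power_int_minus field_simps)

lemma th_1_minus: "th 1 (- i) = - th 1 i / q powi i"
  using th_reflect[of 1 "- i"] by (simp add: power_int_minus divide_inverse mult_ac)

lemma poch_0 [simp]: "poch x l s 0 = 1"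
  by (simp add: poch_def)

lemma poch_Suc: "poch x l s (Suc k) = poch x l s k * th x (l + s * int k)"
  by (simp add: poch_def)

lemma poch_Suc_left: "poch x l s (Suc k) = th x l * poch x (l + s) s k"
  by (simp add: poch_def prod.lessThan_Suc_shift algebra_simps del: prod.lessThan_Suc)

lemma poch_shift: "th x l * poch x (l + s) s k = poch x l s k * th x (l + s * int k)"
  using poch_Suc poch_Suc_left by simp

lemma poch_add: "poch x l s (j + k) = poch x l s j * poch x (l + s * int j) s k"
  by (induction k) (simp_all add: poch_Suc algebra_simps)

lemma poch_translate: "poch (x * q powi j) l s k = poch x (l + j) s k"
  by (simp add: poch_def th_shift algebra_simps)

lemma poch_nonzero:
  assumes "\<And>i. th x i \<noteq> 0"
  shows "poch x l s k \<noteq> 0"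
  using assms by (simp add: poch_def)

section \<open>The two instances of the addition formula behind the cubic summation\<close>

definition ethe2_exp :: "complex \<Rightarrow> int \<Rightarrow> int \<Rightarrow> complex" where
  "ethe2_exp K t s = th K (t + s) * th 1 (t - s) / q powi t"

lemma ethe2_powi: "ethe2 p K (q powi t) (q powi s) = ethe2_exp K t s"
  using q by (simp add: ethe2_def ethe2_exp_def th_def power_int_add power_int_diff mult_ac)

lemma three_term_coeff:
  assumes a: "a \<noteq> 0"
  shows "th a (4 * int k - 1) * th a (2 * int n + 2) * th 1 (int n + int k + 1) * th 1 (int n + int k + 2)
    = q ^ (3 * k) * th a (int k - 1) * th a (2 * int n + 2 + 3 * int k)
          * th 1 (int n + 2 - 2 * int k) * th 1 (int n + 1 - 2 * int k)
      + th a (int n + 2 * int k) * th a (int n + 2 * int k + 1) * th 1 (2 * int n + 3 - int k) * th 1 (3 * int k)"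
proof -
  \<comment> \<open>The four points are powers of q. Their pairwise sums, offset by the exponent 3k
    - n - 3 of q in \<open>K\<close>, are the six exponents at \<open>a\<close> in the claim; their
    differences are up to sign the six exponents at 1.\<close>
  define X Y U V where "X = (0::int)" and "Y = int n + 2 + int k" and "U = int n + 2 - 2 * int k"
    and "V = 2 * int n + 3 - int k"
  define K where "K = a * q powi (3 * int k - int n - 3)"
  have Kth: "th K i = th a (i + (3 * int k - int n - 3))" for i
    unfolding K_def th_shift ..
  have K: "K \<noteq> 0" using a q by (simp add: K_def)
  define N M where "N = q ^ n" and "M = q ^ k"
  have nz: "N \<noteq> 0" "M \<noteq> 0" using q by (auto simp: N_def M_def)
  have pw: "q powi (int n + int k + 2) = N * M * q\<^sup>2" "q powi (int n + int k + 1) = N * M * q"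
    "q powi U = N * q\<^sup>2 / M\<^sup>2" "q powi (int n + 2 - 2 * int k) = N * q\<^sup>2 / M\<^sup>2" "q powi (int n + 1 - 2 * int k) = N * q / M\<^sup>2"
    "q powi Y = N * q\<^sup>2 * M" "q powi (2 * int n + 3 - int k) = N\<^sup>2 * q ^ 3 / M"
    unfolding U_def Y_def N_def M_def by (simp_all add: powi_expand)
  have M3: "q ^ (3 * k) = M ^ 3"
    unfolding M_def by (simp only: mult.commute[of 3] power_mult)
  have "ethe2_exp K X Y * ethe2_exp K U V = ethe2_exp K X U * ethe2_exp K Y V - ethe2_exp K X V * ethe2_exp K Y U"
    unfolding ethe2_powi[symmetric] using q by (intro ethe2_pluecker p K) simp_all
  also have "ethe2_exp K X Y = th a (4 * int k - 1) * (- th 1 (int n + int k + 2) / (N * M * q\<^sup>2))"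
    using th_1_minus[of "int n + int k + 2"] unfolding pw by (simp add: ethe2_exp_def Kth X_def Y_def algebra_simps)
  also have "ethe2_exp K U V = th a (2 * int n + 2) * (- th 1 (int n + int k + 1) / (N * M * q)) / (N * q\<^sup>2 / M\<^sup>2)"
    using th_1_minus[of "int n + int k + 1"] unfolding ethe2_exp_def pw
    by (simp add: Kth U_def V_def algebra_simps)
  also have "ethe2_exp K X U = th a (int k - 1) * (- th 1 (int n + 2 - 2 * int k) / (N * q\<^sup>2 / M\<^sup>2))"
    using th_1_minus[of "int n + 2 - 2 * int k"] unfolding pw by (simp add: ethe2_exp_def Kth X_def U_def algebra_simps)
  also have "ethe2_exp K Y V = th a (2 * int n + 2 + 3 * int k) * (- th 1 (int n + 1 - 2 * int k) / (N * q / M\<^sup>2)) / (N * q\<^sup>2 * M)"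
    using th_1_minus[of "int n + 1 - 2 * int k"] unfolding ethe2_exp_def pw
    by (simp add: Kth Y_def V_def algebra_simps)
  also have "ethe2_exp K X V = th a (int n + 2 * int k) * (- th 1 (2 * int n + 3 - int k) / (N\<^sup>2 * q ^ 3 / M))"
    using th_1_minus[of "2 * int n + 3 - int k"] unfolding pw by (simp add: ethe2_exp_def Kth X_def V_def algebra_simps)
  also have "ethe2_exp K Y U = th a (int n + 2 * int k + 1) * th 1 (3 * int k) / (N * q\<^sup>2 * M)"
    unfolding ethe2_exp_def pw by (simp add: Kth Y_def U_def algebra_simps)
  finally have eq: "th a (4 * int k - 1) * (- th 1 (int n + int k + 2) / (N * M * q\<^sup>2))
      * (th a (2 * int n + 2) * (- th 1 (int n + int k + 1) / (N * M * q)) / (N * q\<^sup>2 / M\<^sup>2))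
    = th a (int k - 1) * (- th 1 (int n + 2 - 2 * int k) / (N * q\<^sup>2 / M\<^sup>2))
      * (th a (2 * int n + 2 + 3 * int k) * (- th 1 (int n + 1 - 2 * int k) / (N * q / M\<^sup>2)) / (N * q\<^sup>2 * M))
     - th a (int n + 2 * int k) * (- th 1 (2 * int n + 3 - int k) / (N\<^sup>2 * q ^ 3 / M))
      * (th a (int n + 2 * int k + 1) * th 1 (3 * int k) / (N * q\<^sup>2 * M))" .
  \<comment> \<open>With the theta values replaced by free variables only powers of q remain to be
    compared; N^3 q^5 is the common denominator on the left.\<close>
  have clear: "z1 * z2 * w1 * w2 = M ^ 3 * x1 * x2 * u1 * u2 + y1 * y2 * v1 * v2"
    if "z1 * (- w2 / (N * M * q\<^sup>2)) * (z2 * (- w1 / (N * M * q)) / (N * q\<^sup>2 / M\<^sup>2))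
      = x1 * (- u1 / (N * q\<^sup>2 / M\<^sup>2)) * (x2 * (- u2 / (N * q / M\<^sup>2)) / (N * q\<^sup>2 * M))
       - y1 * (- v1 / (N\<^sup>2 * q ^ 3 / M)) * (y2 * v2 / (N * q\<^sup>2 * M))"
    for z1 z2 w1 w2 x1 x2 u1 u2 y1 y2 v1 v2
  proof -
    have "z1 * z2 * w1 * w2 = N ^ 3 * q ^ 5 *
        (z1 * (- w2 / (N * M * q\<^sup>2)) * (z2 * (- w1 / (N * M * q)) / (N * q\<^sup>2 / M\<^sup>2)))"
      using nz q by (simp add: field_simps power_numeral_reduce)
    also have "\<dots> = M ^ 3 * x1 * x2 * u1 * u2 + y1 * y2 * v1 * v2"
      unfolding that using nz q by (simp add: field_simps power_numeral_reduce)
    finally show ?thesis .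
  qed
  show ?thesis unfolding M3 by (rule clear[OF eq])
qed

lemma three_term_bc:
  assumes a: "a \<noteq> 0" and b: "b \<noteq> 0" and c: "c \<noteq> 0" and bc: "b * c = a ^ 2 * q ^ (n + 1)"
  shows "th (a / b) (2 * int n + 2) * th (a / c) (2 * int n + 2) * th a (4 * int k) * th a (int n + 1 + 2 * int k)
    = q powi (2 * int n + 2 - int k) * th a (2 * int n + 2 + 3 * int k) * th a (3 * int k - int n - 1)
         * th (a / b) (int k) * th (a / c) (int k)
      + th 1 (int n + 1 + int k) * th 1 (2 * int n + 2 - int k) * th b (3 * int k) * th c (3 * int k)"
proof -
  define N M where "N = q ^ n" and "M = q ^ k"
  have nz: "N \<noteq> 0" "M \<noteq> 0" using q by (auto simp: N_def M_def)
  define K where "K = b * c"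
  have Ka: "K = a\<^sup>2 * N * q" using bc by (simp add: K_def N_def)
  have K: "K \<noteq> 0" using b c by (simp add: K_def)
  \<comment> \<open>The products \<open>K * t2 * t3\<close>, \<open>K * t1 * t2\<close>,
    \<open>K * t1 * t3\<close> and the matching quotients are free of b and c: all dependence on
    them is carried by the fourth point 1/c.\<close>
  define t1 t2 t3 where "t1 = N * q / a" and "t2 = M ^ 3" and "t3 = M / (N * q * a)"
  have tnz: "t1 \<noteq> 0" "t2 \<noteq> 0" "t3 \<noteq> 0" using nz a q by (auto simp: t1_def t2_def t3_def)
  have pw: "q powi (2 * int n + 2) = N\<^sup>2 * q\<^sup>2" "q powi (4 * int k) = M ^ 4" "q powi (int n + 1 + 2 * int k) = N * q * M\<^sup>2"
     "q powi (2 * int n + 2 - int k) = N\<^sup>2 * q\<^sup>2 / M" "q powi (2 * int n + 2 + 3 * int k) = N\<^sup>2 * q\<^sup>2 * M ^ 3"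
     "q powi (3 * int k - int n - 1) = M ^ 3 / (N * q)" "q powi (int k) = M" "q powi (int n + 1 + int k) = N * q * M"
     "q powi (3 * int k) = M ^ 3"
    unfolding N_def M_def by (simp_all add: powi_expand)
  have cc: "c = a\<^sup>2 * N * q / b" using Ka b by (simp add: K_def field_simps)
  \<comment> \<open>As \<open>K = b * c\<close>, the second point 1/c turns the two arguments of the
    kernel into t b and t c.\<close>
  have F: "ethe2 p K t (1 / c) = ethe p (t * b) * ethe p (t * c) / t" for t
    using c by (simp add: ethe2_def K_def mult_ac)
  have "ethe2 p K t1 (1 / c) * ethe2 p K t2 t3 = ethe2 p K t1 t2 * ethe2 p K (1 / c) t3 - ethe2 p K t1 t3 * ethe2 p K (1 / c) t2"
    using tnz c by (intro ethe2_pluecker p K) auto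
  also have "ethe2 p K (1 / c) t3 = - ethe2 p K t3 (1 / c)"
    using tnz c by (intro ethe2_antisym p) auto
  also have "ethe2 p K (1 / c) t2 = - ethe2 p K t2 (1 / c)"
    using tnz c by (intro ethe2_antisym p) auto
  finally have main: "ethe2 p K t1 (1 / c) * ethe2 p K t2 t3 
     = - (ethe2 p K t1 t2 * ethe2 p K t3 (1 / c)) + ethe2 p K t1 t3 * ethe2 p K t2 (1 / c)" by simp
  have 1: "ethe2 p K t1 (1 / c) = th (a / b) (2 * int n + 2) * th (a / c) (2 * int n + 2) / t1"
    using a b q nz unfolding F unfolding th_def pw t1_def cc by (simp add: field_simps power2_eq_square)
  have 2: "ethe2 p K t2 (1 / c) = th b (3 * int k) * th c (3 * int k) / t2"
    unfolding F unfolding th_def pw t2_def by (simp add: mult_ac)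
  have 3: "ethe2 p K t3 (1 / c) = th (a / b) (int k) * th (a / c) (int k) / t3"
    using a b q nz unfolding F unfolding th_def pw t3_def cc by (simp add: field_simps power2_eq_square)
  have 4: "ethe2 p K t2 t3 = th a (4 * int k) * th a (int n + 1 + 2 * int k) / t2"
  proof -
    have "K * t2 * t3 = a * M ^ 4" "t2 / t3 = a * (N * q * M\<^sup>2)"
      using a q nz by (simp_all add: Ka t2_def t3_def field_simps power2_eq_square power3_eq_cube power4_eq_xxxx)
    then show ?thesis by (simp add: ethe2_def th_def pw)
  qed
  have 5: "ethe2 p K t1 t2 = - (N * q / (a * M ^ 3)) * th a (2 * int n + 2 + 3 * int k) * th a (3 * int k - int n - 1) / t1"
  proof -
    have "K * t1 * t2 = a * (N\<^sup>2 * q\<^sup>2 * M ^ 3)" "t1 / t2 = 1 / (a * (M ^ 3 / (N * q)))"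
      using a q nz by (simp_all add: Ka t1_def t2_def field_simps power2_eq_square)
    then show ?thesis
      using ethe_inverse[OF p, of "a * (M ^ 3 / (N * q))"] a q nz by (simp add: ethe2_def th_def pw)
  qed
  have 6: "ethe2 p K t1 t3 = th 1 (int n + 1 + int k) * th 1 (2 * int n + 2 - int k) / t1"
  proof -
    have "K * t1 * t3 = N * q * M" "t1 / t3 = N\<^sup>2 * q\<^sup>2 / M"
      using a q nz by (simp_all add: Ka t1_def t3_def field_simps power2_eq_square)
    then show ?thesis by (simp add: ethe2_def th_def pw)
  qed
  have clear: "x * y * z * w = N\<^sup>2 * q\<^sup>2 / M * u1 * u2 * u3 * u4 + v1 * v2 * v3 * v4"
    if "x * y / t1 * (z * w / t2) = - (- (N * q / (a * M ^ 3)) * u1 * u2 / t1 * (u3 * u4 / t3)) + v1 * v2 / t1 * (v3 * v4 / t2)"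
    for x y z w u1 u2 u3 u4 v1 v2 v3 v4
  proof -
    have "x * y * z * w = t1 * t2 * (x * y / t1 * (z * w / t2))"
      using tnz by simp
    also have "\<dots> = N\<^sup>2 * q\<^sup>2 / M * u1 * u2 * u3 * u4 + v1 * v2 * v3 * v4"
      unfolding that unfolding t1_def t2_def t3_def
      using nz a q by (simp add: field_simps power2_eq_square power3_eq_cube)
    finally show ?thesis .
  qed
  show ?thesis unfolding pw(4) by (rule clear[OF main[unfolded 1 2 3 4 5 6]])
qed

end

section \<open>The cubic summation\<close>

context theta_base begin

text \<open>The \<open>k\<close>-th term on the left of the theorem for \<open>d = a\<close>, \<open>e = q\<^bsup>n+1\<^esup>\<close>.\<close>

definition cubic_term :: "nat \<Rightarrow> complex \<Rightarrow> complex \<Rightarrow> complex \<Rightarrow> nat \<Rightarrow> complex" where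
  "cubic_term n a b c k = th a (4 * int k) / th a 0
     * (poch b 0 3 k * poch c 0 3 k) / (poch (a / b) 1 1 k * poch (a / c) 1 1 k)
     * (poch 1 (- int n) 1 (2 * k) / poch a (int n + 1) 1 (2 * k))
     * (poch a 0 1 k * poch 1 (int n + 1) 1 k) / (poch 1 3 3 k * poch a (2 - int n) 3 k) * q ^ k"

text \<open>This quotient in front of the series is also the value of the cubic sum: for d = a the
  numerator parameter a/d = 1 leaves only the first term of the series.\<close>

definition prefactor :: "nat \<Rightarrow> complex \<Rightarrow> complex \<Rightarrow> complex" where
  "prefactor n a b = poch a 1 1 n * poch (a / b) (2 - int n) 3 n / (poch (a / b) 1 1 n * poch a (2 - int n) 3 n)"

text \<open>The constraint says a/c = (b/a) q^(-n-1), so theta values at a/c are reflections of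
  those at a/b. Nonvanishing at a/c is thus inherited from a/b.\<close>

lemma th_a_over_c:
  assumes "a \<noteq> 0" "b \<noteq> 0" "c \<noteq> 0" "b * c = a ^ 2 * q ^ (n + 1)"
  shows "th (a / c) i = - (q powi (i - int n - 1) * b / a) * th (a / b) (int n + 1 - i)"
proof -
  have "a / c = 1 / (a / b) * q powi (- int n - 1)"
    using assms q by (simp add: power_int_diff power_int_minus field_simps power2_eq_square)
  then have "th (a / c) i = th (1 / (a / b)) (i + (- int n - 1))"
    by (simp only: th_shift)
  also have "\<dots> = - (q powi (i - int n - 1) / (a / b)) * th (a / b) (int n + 1 - i)"
    using th_reflect[of "a / b" "i + (- int n - 1)"] assms by (simp add: algebra_simps)
  finally show ?thesis by simp
qed

section \<open>The induction step of the cubic summation\<close>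

context
  fixes n :: nat and a b c :: complex
  assumes nz: "a \<noteq> 0" "b \<noteq> 0" "c \<noteq> 0" and bc: "b * c = a ^ 2 * q ^ (n + 1)"
    and ga: "\<And>i. th a i \<noteq> 0" and gb: "\<And>i. th (a / b) i \<noteq> 0" and g1: "\<And>i. i \<noteq> 0 \<Longrightarrow> th 1 i \<noteq> 0"
begin

lemma minus_2_plus_1: "- int n - 2 + 1 = - int n - 1"
  by simp

lemma gc: "th (a / c) i \<noteq> 0"
  unfolding th_a_over_c[OF nz bc] using nz q gb by simp

text \<open>Some theta values at a/b are written as values at a/c, so that they cancel against the
  denominators of the weights below.\<close>

definition prefactor_ratio :: complex where
  "prefactor_ratio = th a 0 * th a (int n + 1) * th (a / c) (2 * int n + 2) * th (a / b) (2 * int n + 2)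
     / ((q ^ n)\<^sup>2 * q\<^sup>2 * th (a / b) 0 * th (a / c) 0 * th a (- int n - 1) * th a (2 * int n + 2))"

lemma prefactor_step: "prefactor (n + 2) (a / q) b = prefactor_ratio * prefactor n a b"
proof -
  \<comment> \<open>Replacing (n, a) by (n + 2, a/q) adds one factor at each end of each of the four
    products.\<close>
  have ends: "poch x l s (n + 2) = th x l * poch x (l + s) s n * th x (l + s * (int n + 1))" for x l s
    using poch_Suc_left[of x l s "Suc n"] poch_Suc[of x "l + s" s n] by (simp add: algebra_simps)
  have C0: "th (a / c) 0 = - (b / a / (q ^ n * q)) * th (a / b) (int n + 1)"
    using th_a_over_c[OF nz bc, of 0] q by (simp add: power_int_diff power_int_minus divide_inverse mult_ac)
  have C2: "th (a / c) (2 * int n + 2) = - (q ^ n * q * b / a) * th (a / b) (- int n - 1)"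
    using th_a_over_c[OF nz bc, of "2 * int n + 2"] q by (simp add: power_int_add)
  have "prefactor (n + 2) (a / q) b
    = (th a 0 * poch a 1 1 n * th a (int n + 1)) * (th (a / b) (- int n - 1) * poch (a / b) (2 - int n) 3 n * th (a / b) (2 * int n + 2))
      / ((th (a / b) 0 * poch (a / b) 1 1 n * th (a / b) (int n + 1)) * (th a (- int n - 1) * poch a (2 - int n) 3 n * th a (2 * int n + 2)))"
    unfolding prefactor_def poch_divide_q poch_divide_q' unfolding ends by (simp add: algebra_simps)
  also have "\<dots> = prefactor_ratio * prefactor n a b"
    unfolding prefactor_ratio_def prefactor_def C0 C2
    using nz q ga gb poch_nonzero[of a, OF ga] poch_nonzero[of "a / b", OF gb]
    by (simp add: divide_simps power2_eq_square)
  finally show ?thesis .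
qed

text \<open>
  By \<open>three_term_bc\<close> these weights split a term into the part contributing to index \<open>k\<close> and the
  part contributing to index \<open>k + 1\<close> of the sum for \<open>(n + 2, a/q)\<close>; by \<open>three_term_coeff\<close> the
  weights \<open>coeff_stay\<close>, \<open>coeff_move\<close> below are the shares of the two parts in a term of the new sum.
\<close>

definition weight_stay :: "nat \<Rightarrow> complex" where
  "weight_stay k = q powi (2 * int n + 2 - int k) * th a (2 * int n + 2 + 3 * int k) * th a (3 * int k - int n - 1)
         * th (a / b) (int k) * th (a / c) (int k)
     / (th (a / b) (2 * int n + 2) * th (a / c) (2 * int n + 2) * th a (4 * int k) * th a (int n + 1 + 2 * int k))"

definition weight_move :: "nat \<Rightarrow> complex" where
  "weight_move k = th 1 (int n + 1 + int k) * th 1 (2 * int n + 2 - int k) * th b (3 * int k) * th c (3 * int k)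
     / (th (a / b) (2 * int n + 2) * th (a / c) (2 * int n + 2) * th a (4 * int k) * th a (int n + 1 + 2 * int k))"

lemma weight_stay_add_move: "weight_stay k + weight_move k = 1"
  unfolding weight_stay_def weight_move_def add_divide_distrib[symmetric] three_term_bc[OF nz bc, of k, symmetric]
  using ga gb gc by simp

definition coeff_stay :: "nat \<Rightarrow> complex" where
  "coeff_stay k = q ^ (3 * k) * th a (int k - 1) * th a (2 * int n + 2 + 3 * int k)
          * th 1 (int n + 2 - 2 * int k) * th 1 (int n + 1 - 2 * int k)
    / (th a (4 * int k - 1) * th a (2 * int n + 2) * th 1 (int n + int k + 1) * th 1 (int n + int k + 2))"

definition coeff_move :: "nat \<Rightarrow> complex" where
  "coeff_move k = th a (int n + 2 * int k) * th a (int n + 2 * int k + 1) * th 1 (2 * int n + 3 - int k) * th 1 (3 * int k)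
    / (th a (4 * int k - 1) * th a (2 * int n + 2) * th 1 (int n + int k + 1) * th 1 (int n + int k + 2))"

lemma coeff_stay_add_move: "coeff_stay k + coeff_move k = 1"
  unfolding coeff_stay_def coeff_move_def add_divide_distrib[symmetric] three_term_coeff[OF nz(1), of k n, symmetric]
  using ga g1 by simp

text \<open>The products in b and c alone agree on both sides, and every other product changes by at
  most two factors at its ends, so the claim is a cancellation of theta values.\<close>

lemma cubic_term_stay:
  assumes k: "2 * k \<le> n"
  shows "prefactor_ratio * cubic_term n a b c k * weight_stay k = cubic_term (n + 2) (a / q) b c k * coeff_stay k"
proof -
  define N M where "N = q ^ n" and "M = q ^ k"
  have M3: "q ^ (3 * k) = M ^ 3"
    unfolding M_def by (simp only: mult.commute[of 3] power_mult)
  have pw: "q powi (2 * int n + 2 - int k) = N\<^sup>2 * q\<^sup>2 / M"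
    "q powi (int n + 2) = N * q\<^sup>2" "q powi (int n + 1) = N * q"
    "q powi (int n + 2 - 2 * int k) = N * q\<^sup>2 / M\<^sup>2" "q powi (int n + 1 - 2 * int k) = N * q / M\<^sup>2"
    unfolding N_def M_def by (simp_all add: powi_expand)
  have NM: "N \<noteq> 0" "M \<noteq> 0" using q by (auto simp: N_def M_def)
  have PB: "poch (a / b) 0 1 k = th (a / b) 0 * poch (a / b) 1 1 k / th (a / b) (int k)"
    using poch_shift[of "a / b" 0 1 k] gb by (simp add: field_simps)
  have PC: "poch (a / c) 0 1 k = th (a / c) 0 * poch (a / c) 1 1 k / th (a / c) (int k)"
    using poch_shift[of "a / c" 0 1 k] gc by (simp add: field_simps)
  have PA: "poch a (int n + 2) 1 (2 * k) = poch a (int n + 1) 1 (2 * k) * th a (int n + 1 + 2 * int k) / th a (int n + 1)"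
    using poch_shift[of a "int n + 1" 1 "2 * k"] ga by (simp add: eq_divide_eq algebra_simps)
  have Pa: "poch a (- 1) 1 k = th a (- 1) * poch a 0 1 k / th a (int k - 1)"
    using poch_shift[of a "- 1" 1 k] ga by (simp add: eq_divide_eq algebra_simps)
  have PX: "poch a (- int n - 1) 3 k = th a (- int n - 1) * poch a (2 - int n) 3 k / th a (3 * int k - int n - 1)"
    using poch_shift[of a "- int n - 1" 3 k] ga by (simp add: eq_divide_eq algebra_simps)
  have Po: "poch 1 (int n + 3) 1 k = poch 1 (int n + 1) 1 k * th 1 (int n + int k + 1) * th 1 (int n + int k + 2)
      / (th 1 (int n + 1) * th 1 (int n + 2))"
    using poch_shift[of 1 "int n + 1" 1 k] poch_shift[of 1 "int n + 2" 1 k] g1[of "int n + 1"] g1[of "int n + 2"]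
    by (simp add: eq_divide_eq algebra_simps)
  have r2: "th 1 (- int n - 2) = - th 1 (int n + 2) / (N * q\<^sup>2)"
    using th_1_minus[of "int n + 2"] unfolding pw by simp
  have r1: "th 1 (- int n - 1) = - th 1 (int n + 1) / (N * q)"
    using th_1_minus[of "int n + 1"] unfolding pw by simp
  have s2: "th 1 (2 * int k - int n - 2) = - th 1 (int n + 2 - 2 * int k) / (N * q\<^sup>2 / M\<^sup>2)"
    using th_1_minus[of "int n + 2 - 2 * int k"] unfolding pw by (simp add: algebra_simps)
  have s1: "th 1 (2 * int k - int n - 1) = - th 1 (int n + 1 - 2 * int k) / (N * q / M\<^sup>2)"
    using th_1_minus[of "int n + 1 - 2 * int k"] unfolding pw by (simp add: algebra_simps)
  \<comment> \<open>The two factors removed at the upper end are nonzero only because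
    \<open>2 * k \<le> n\<close>; beyond that the product meets \<open>th 1 0\<close>.\<close>
  have PO: "poch 1 (- int n - 2) 1 (2 * k) = th 1 (- int n - 2) * th 1 (- int n - 1) * poch 1 (- int n) 1 (2 * k)
      / (th 1 (2 * int k - int n - 2) * th 1 (2 * int k - int n - 1))"
  proof -
    have "th 1 (- int n - 2) * poch 1 (- int n - 1) 1 (2 * k) = poch 1 (- int n - 2) 1 (2 * k) * th 1 (2 * int k - int n - 2)"
      "th 1 (- int n - 1) * poch 1 (- int n) 1 (2 * k) = poch 1 (- int n - 1) 1 (2 * k) * th 1 (2 * int k - int n - 1)"
      using poch_shift[of 1 "- int n - 2" 1 "2 * k", unfolded minus_2_plus_1]
        poch_shift[of 1 "- int n - 1" 1 "2 * k"] by (simp_all add: algebra_simps)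
    moreover have "th 1 (2 * int k - int n - 2) \<noteq> 0" "th 1 (2 * int k - int n - 1) \<noteq> 0"
      using k by (auto intro!: g1)
    moreover have "x = r2 * r1 * z / (s2 * s1)" if "r2 * y = x * s2" "r1 * z = y * s1" "s2 \<noteq> 0" "s1 \<noteq> 0"
      for x y z r1 r2 s1 s2 :: complex
    proof -
      have "r2 * r1 * z = x * (s2 * s1)" using that by (metis mult.assoc mult.commute)
      then show ?thesis using that by simp
    qed
    ultimately show ?thesis by blast
  qed
  have S: "cubic_term (n + 2) (a / q) b c k = th a (4 * int k - 1) / th a (- 1)
     * (poch b 0 3 k * poch c 0 3 k) / (poch (a / b) 0 1 k * poch (a / c) 0 1 k)
     * (poch 1 (- int n - 2) 1 (2 * k) / poch a (int n + 2) 1 (2 * k))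
     * (poch a (- 1) 1 k * poch 1 (int n + 3) 1 k) / (poch 1 3 3 k * poch a (- int n - 1) 3 k) * M"
    unfolding cubic_term_def th_divide_q poch_divide_q poch_divide_q' M_def by (simp add: algebra_simps)
  have nonzero: "th 1 (int n + 1) \<noteq> 0" "th 1 (int n + 2) \<noteq> 0" "th 1 (int n + int k + 1) \<noteq> 0" "th 1 (int n + int k + 2) \<noteq> 0"
    "th 1 (int n + 2 - 2 * int k) \<noteq> 0" "th 1 (int n + 1 - 2 * int k) \<noteq> 0"
    using k by (auto intro!: g1)
  have clear: "A0 * An1 * C2 * B2 / (N\<^sup>2 * q\<^sup>2 * B0 * C0 * W * A2n)
      * (A4 / A0 * Pbc / (QB * QC) * (QO / QA) * (Qa * Qo) / (Q3 * QX) * M)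
      * (N\<^sup>2 * q\<^sup>2 / M * Y * X * Bk * Ck / (B2 * C2 * A4 * AA))
    = A4m / Am * Pbc / ((B0 * QB / Bk) * (C0 * QC / Ck))
      * (((- o2 / (N * q\<^sup>2)) * (- o1 / (N * q)) * QO / ((- z2 / (N * q\<^sup>2 / M\<^sup>2)) * (- z1 / (N * q / M\<^sup>2)))) / (QA * AA / An1))
      * ((Am * Qa / Ak) * (Qo * k1 * k2 / (o1 * o2))) / (Q3 * (W * QX / X)) * M
      * (M ^ 3 * Ak * Y * z2 * z1 / (A4m * A2n * k1 * k2))"
    if "A0 \<noteq> 0" "An1 \<noteq> 0" "C2 \<noteq> 0" "B2 \<noteq> 0" "B0 \<noteq> 0" "C0 \<noteq> 0" "W \<noteq> 0" "A2n \<noteq> 0" "A4 \<noteq> 0"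
      "A4m \<noteq> 0" "Am \<noteq> 0" "Bk \<noteq> 0" "Ck \<noteq> 0" "o1 \<noteq> 0" "o2 \<noteq> 0" "z1 \<noteq> 0" "z2 \<noteq> 0" "Ak \<noteq> 0" "k1 \<noteq> 0" "k2 \<noteq> 0" "X \<noteq> 0" "AA \<noteq> 0"
    for A0 An1 C2 B2 B0 C0 W A2n A4 Pbc QB QC QO QA Qa Qo Q3 QX Y X Bk Ck AA A4m Am o1 o2 z1 z2 Ak k1 k2 :: complex
    using that NM q by (simp add: field_simps power_numeral_reduce)
  show ?thesis
    unfolding S PB PC PA Pa PX Po PO r2 r1 s2 s1 unfolding cubic_term_def prefactor_ratio_def weight_stay_def coeff_stay_def M3 pw(1)
      N_def[symmetric] M_def[symmetric]
    by (rule clear) (use ga gb gc nonzero in auto)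
qed

text \<open>Now the target index is k + 1, so most products gain factors at the lower end, and the
  terminating product is extended by two factors without any division.\<close>

lemma cubic_term_move:
  assumes k: "2 * k \<le> n"
  shows "prefactor_ratio * cubic_term n a b c k * weight_move k = cubic_term (n + 2) (a / q) b c (Suc k) * coeff_move (Suc k)"
proof -
  define N M where "N = q ^ n" and "M = q ^ k"
  have pw: "q powi (int n + 2) = N * q\<^sup>2" "q powi (int n + 1) = N * q"
    unfolding N_def M_def by (simp_all add: powi_expand)
  have NM: "N \<noteq> 0" "M \<noteq> 0" using q by (auto simp: N_def M_def)
  have PA: "poch a (int n + 2) 1 (2 * k + 2) = poch a (int n + 1) 1 (2 * k) * th a (int n + 1 + 2 * int k)
       * th a (int n + 2 * int k + 2) * th a (int n + 2 * int k + 3) / th a (int n + 1)"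
  proof -
    have "poch a (int n + 1) 1 (2 * k + 3) = th a (int n + 1) * poch a (int n + 2) 1 (2 * k + 2)"
      using poch_Suc_left[of a "int n + 1" 1 "2 * k + 2"] by (simp add: numeral_3_eq_3 add.assoc)
    moreover have "poch a (int n + 1) 1 (2 * k + 3) = poch a (int n + 1) 1 (2 * k) * th a (int n + 1 + 2 * int k)
       * th a (int n + 2 * int k + 2) * th a (int n + 2 * int k + 3)"
      by (simp add: numeral_3_eq_3 poch_Suc algebra_simps)
    ultimately show ?thesis using ga by (simp add: eq_divide_eq)
  qed
  have Po: "poch 1 (int n + 3) 1 (Suc k) = poch 1 (int n + 1) 1 k * th 1 (int n + 1 + int k) * th 1 (int n + int k + 2)
      * th 1 (int n + int k + 3) / (th 1 (int n + 1) * th 1 (int n + 2))"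
  proof -
    have "poch 1 (int n + 1) 1 (k + 3) = th 1 (int n + 1) * (th 1 (int n + 2) * poch 1 (int n + 3) 1 (Suc k))"
      using poch_Suc_left[of 1 "int n + 1" 1 "k + 2"] poch_Suc_left[of 1 "int n + 2" 1 "k + 1"]
      by (simp add: numeral_3_eq_3 add.assoc)
    moreover have "poch 1 (int n + 1) 1 (k + 3) = poch 1 (int n + 1) 1 k * th 1 (int n + 1 + int k)
       * th 1 (int n + int k + 2) * th 1 (int n + int k + 3)"
      by (simp add: numeral_3_eq_3 poch_Suc algebra_simps)
    ultimately show ?thesis using g1[of "int n + 1"] g1[of "int n + 2"] by (simp add: eq_divide_eq mult_ac)
  qed
  have r2: "th 1 (- int n - 2) = - th 1 (int n + 2) / (N * q\<^sup>2)"
    using th_1_minus[of "int n + 2"] unfolding pw by simp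
  have r1: "th 1 (- int n - 1) = - th 1 (int n + 1) / (N * q)"
    using th_1_minus[of "int n + 1"] unfolding pw by simp
  have PO: "poch 1 (- int n - 2) 1 (2 * k + 2) = th 1 (- int n - 2) * th 1 (- int n - 1) * poch 1 (- int n) 1 (2 * k)"
    using poch_Suc_left[of 1 "- int n - 2" 1 "2 * k + 1", unfolded minus_2_plus_1]
      poch_Suc_left[of 1 "- int n - 1" 1 "2 * k"] by simp
  have "cubic_term (n + 2) (a / q) b c (Suc k) = th a (4 * int k + 3) / th a (- 1)
     * (poch b 0 3 (Suc k) * poch c 0 3 (Suc k)) / (poch (a / b) 0 1 (Suc k) * poch (a / c) 0 1 (Suc k))
     * (poch 1 (- int n - 2) 1 (2 * k + 2) / poch a (int n + 2) 1 (2 * k + 2))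
     * (poch a (- 1) 1 (Suc k) * poch 1 (int n + 3) 1 (Suc k)) / (poch 1 3 3 (Suc k) * poch a (- int n - 1) 3 (Suc k)) * (M * q)"
    unfolding cubic_term_def th_divide_q poch_divide_q poch_divide_q' M_def by (simp add: algebra_simps)
  also have "poch (a / b) 0 1 (Suc k) = th (a / b) 0 * poch (a / b) 1 1 k" by (simp add: poch_Suc_left)
  also have "poch (a / c) 0 1 (Suc k) = th (a / c) 0 * poch (a / c) 1 1 k" by (simp add: poch_Suc_left)
  also have "poch a (- 1) 1 (Suc k) = th a (- 1) * poch a 0 1 k" by (simp add: poch_Suc_left)
  also have "poch a (- int n - 1) 3 (Suc k) = th a (- int n - 1) * poch a (2 - int n) 3 k" by (simp add: poch_Suc_left)
  also have "poch b 0 3 (Suc k) = poch b 0 3 k * th b (3 * int k)" by (simp add: poch_Suc)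
  also have "poch c 0 3 (Suc k) = poch c 0 3 k * th c (3 * int k)" by (simp add: poch_Suc)
  also have "poch 1 3 3 (Suc k) = poch 1 3 3 k * th 1 (3 * int k + 3)" by (simp add: poch_Suc algebra_simps)
  finally have S: "cubic_term (n + 2) (a / q) b c (Suc k) = th a (4 * int k + 3) / th a (- 1)
     * (poch b 0 3 k * th b (3 * int k) * (poch c 0 3 k * th c (3 * int k))) / (th (a / b) 0 * poch (a / b) 1 1 k * (th (a / c) 0 * poch (a / c) 1 1 k))
     * (poch 1 (- int n - 2) 1 (2 * k + 2) / poch a (int n + 2) 1 (2 * k + 2))
     * (th a (- 1) * poch a 0 1 k * poch 1 (int n + 3) 1 (Suc k)) / (poch 1 3 3 k * th 1 (3 * int k + 3) * (th a (- int n - 1) * poch a (2 - int n) 3 k)) * (M * q)" .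
  have V: "coeff_move (Suc k) = th a (int n + 2 * int k + 2) * th a (int n + 2 * int k + 3) * th 1 (2 * int n + 2 - int k) * th 1 (3 * int k + 3)
    / (th a (4 * int k + 3) * th a (2 * int n + 2) * th 1 (int n + int k + 2) * th 1 (int n + int k + 3))"
    unfolding coeff_move_def by (simp add: algebra_simps)
  have nonzero: "th 1 (int n + 1) \<noteq> 0" "th 1 (int n + 2) \<noteq> 0" "th 1 (int n + int k + 2) \<noteq> 0" "th 1 (int n + int k + 3) \<noteq> 0"
    "th 1 (3 * int k + 3) \<noteq> 0"
    using k by (auto intro!: g1)
  have clear: "A0 * An1 * C2 * B2 / (N\<^sup>2 * q\<^sup>2 * B0 * C0 * W * A2n)
      * (A4 / A0 * (Qb * Qc) / (QB * QC) * (QO / QA) * (Qa * Qo) / (Q3 * QX) * M)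
      * (k1 * z * b3 * c3 / (B2 * C2 * A4 * AA))
    = A43 / Am * (Qb * b3 * (Qc * c3)) / (B0 * QB * (C0 * QC))
      * (((- o2 / (N * q\<^sup>2)) * (- o1 / (N * q)) * QO) / (QA * AA * A1 * A2 / An1))
      * (Am * Qa * (Qo * k1 * k2 * k3 / (o1 * o2))) / (Q3 * o3 * (W * QX)) * (M * q)
      * (A1 * A2 * z * o3 / (A43 * A2n * k2 * k3))"
    if "A0 \<noteq> 0" "An1 \<noteq> 0" "C2 \<noteq> 0" "B2 \<noteq> 0" "B0 \<noteq> 0" "C0 \<noteq> 0" "W \<noteq> 0" "A2n \<noteq> 0" "A4 \<noteq> 0"
      "A43 \<noteq> 0" "Am \<noteq> 0" "o1 \<noteq> 0" "o2 \<noteq> 0" "o3 \<noteq> 0" "k2 \<noteq> 0" "k3 \<noteq> 0" "A1 \<noteq> 0" "A2 \<noteq> 0"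
    for A0 An1 C2 B2 B0 C0 W A2n A4 Qb Qc QB QC QO QA Qa Qo Q3 QX AA A43 Am o1 o2 o3 z k1 k2 k3 A1 A2 b3 c3 :: complex
    using that NM q by (simp add: field_simps power_numeral_reduce)
  show ?thesis
    unfolding S PA PO Po V r2 r1 unfolding cubic_term_def prefactor_ratio_def weight_move_def
      N_def[symmetric] M_def[symmetric]
    by (rule clear) (use ga gb gc nonzero in auto)
qed

lemma sum_cubic_term_step:
  assumes IH: "(\<Sum>k\<le>n div 2. cubic_term n a b c k) = prefactor n a b"
  shows "(\<Sum>k\<le>(n + 2) div 2. cubic_term (n + 2) (a / q) b c k) = prefactor (n + 2) (a / q) b"
proof -
  define N where "N = n div 2"
  have N: "(n + 2) div 2 = Suc N" by (simp add: N_def)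
  \<comment> \<open>One of the two exponents is 0, depending on the parity of \<open>n\<close>.
    Together with \<open>move_0\<close> this removes both boundary terms, so the two pieces cover
    the same range of \<open>k\<close>.\<close>
  have stay_last: "coeff_stay (Suc N) = 0"
  proof -
    have "int n + 2 - 2 * int (Suc N) = 0 \<or> int n + 1 - 2 * int (Suc N) = 0"
      unfolding N_def by presburger
    then show ?thesis unfolding coeff_stay_def using th_1_0 by (auto simp del: of_nat_Suc)
  qed
  have move_0: "coeff_move 0 = 0" by (simp add: coeff_move_def th_1_0)
  let ?s = "cubic_term (n + 2) (a / q) b c"
  have "(\<Sum>k\<le>Suc N. ?s k) = (\<Sum>k\<le>Suc N. ?s k * coeff_stay k) + (\<Sum>k\<le>Suc N. ?s k * coeff_move k)"
    by (simp only: sum.distrib[symmetric] distrib_left[symmetric] coeff_stay_add_move mult_1_right)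
  also have "(\<Sum>k\<le>Suc N. ?s k * coeff_stay k) = (\<Sum>k\<le>N. ?s k * coeff_stay k)"
    by (simp add: stay_last)
  also have "(\<Sum>k\<le>Suc N. ?s k * coeff_move k) = (\<Sum>k\<le>N. ?s (Suc k) * coeff_move (Suc k))"
    by (simp add: sum.atMost_Suc_shift move_0 del: sum.atMost_Suc)
  also have "(\<Sum>k\<le>N. ?s k * coeff_stay k) = (\<Sum>k\<le>N. prefactor_ratio * cubic_term n a b c k * weight_stay k)"
    by (intro sum.cong cubic_term_stay[symmetric] refl) (auto simp: N_def)
  also have "(\<Sum>k\<le>N. ?s (Suc k) * coeff_move (Suc k)) = (\<Sum>k\<le>N. prefactor_ratio * cubic_term n a b c k * weight_move k)"
    by (intro sum.cong cubic_term_move[symmetric] refl) (auto simp: N_def)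
  also have "(\<Sum>k\<le>N. prefactor_ratio * cubic_term n a b c k * weight_stay k) + \<dots> = prefactor_ratio * (\<Sum>k\<le>N. cubic_term n a b c k)"
    by (simp only: sum.distrib[symmetric] distrib_left[symmetric] weight_stay_add_move mult_1_right sum_distrib_left)
  finally show ?thesis unfolding N prefactor_step N_def IH .
qed

end

lemma cubic_sum:
  assumes "a \<noteq> 0" "b \<noteq> 0" "c \<noteq> 0" "b * c = a ^ 2 * q ^ (n + 1)"
    and "\<And>i. th a i \<noteq> 0" "\<And>i. th (a / b) i \<noteq> 0" "\<And>i. i \<noteq> 0 \<Longrightarrow> th 1 i \<noteq> 0"
  shows "(\<Sum>k\<le>n div 2. cubic_term n a b c k) = prefactor n a b"
  using assms
proof (induction n arbitrary: a rule: induct_nat_012)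
  case 0
  then show ?case by (simp add: cubic_term_def prefactor_def)
next
  case 1
  then show ?case by (simp add: cubic_term_def prefactor_def poch_Suc)
next
  case (ge2 n)
  \<comment> \<open>The step leads from a' to a'/q, so the induction hypothesis is needed at aq.
    Nonvanishing was assumed at all integer exponents and survives this shift.\<close>
  define a' where "a' = a * q"
  have a: "a = a' / q" using q by (simp add: a'_def)
  have "th a' i = th a (i + 1)" "th (a' / b) i = th (a / b) (i + 1)" for i
    unfolding a th_divide_q th_divide_q' by simp_all
  moreover have "b * c = a'\<^sup>2 * q ^ (n + 1)"
    using ge2.prems(4) by (simp add: a'_def power2_eq_square)
  moreover have "a' \<noteq> 0" using ge2.prems q by (simp add: a'_def)
  ultimately show ?case
    using sum_cubic_term_step[of a' b c n] ge2.IH(1)[of a'] ge2.prems unfolding a by simp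
qed

end

section \<open>Interpolation in the parameters d and e\<close>

text \<open>Lagrange interpolation with T(z, y) in place of z - y: for the kernel T(x, y) = x - y it
  is the polynomial formula, and the Pluecker relation is all that is used of differences.\<close>

lemma lagrange_pluecker:
  fixes T :: "'a \<Rightarrow> 'a \<Rightarrow> 'b :: field" and w z :: "nat \<Rightarrow> 'a" and k :: nat
  assumes anti: "\<And>x y. x \<in> X \<Longrightarrow> y \<in> X \<Longrightarrow> T y x = - T x y"
    and pluecker: "\<And>x y u v. x \<in> X \<Longrightarrow> y \<in> X \<Longrightarrow> u \<in> X \<Longrightarrow> v \<in> X \<Longrightarrow>
          T x y * T u v = T x u * T y v - T x v * T y u"
    and w: "\<And>i. w i \<in> X" and z: "\<And>i. z i \<in> X"
    and nz: "\<And>i j. i \<noteq> j \<Longrightarrow> T (z i) (z j) \<noteq> 0" and y: "y \<in> X"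
  shows "(\<Prod>i<k. T (w i) y)
    = (\<Sum>j\<le>k. (\<Prod>i<k. T (w i) (z j)) * (\<Prod>i\<in>{..k} - {j}. T (z i) y / T (z i) (z j)))"
  using y
proof (induction k arbitrary: y)
  case 0
  have "{..0} - {0::nat} = {}" by auto
  then show ?case by simp
next
  case (Suc k)
  define W Z where "W = w k" and "Z = z (Suc k)"
  have WZ: "W \<in> X" "Z \<in> X" by (simp_all add: W_def Z_def w z)
  define G where "G = (\<lambda>y j. (\<Prod>i<k. T (w i) (z j)) * (\<Prod>i\<in>{..k} - {j}. T (z i) y / T (z i) (z j)))"
  have IH: "(\<Prod>i<k. T (w i) y) = (\<Sum>j\<le>k. G y j)" if "y \<in> X" for y
    using Suc.IH[OF that] by (simp add: G_def)
  have ZZ: "T Z (z j) \<noteq> 0" "T (z j) Z \<noteq> 0" if "j \<le> k" for j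
    using that nz[of "Suc k" j] nz[of j "Suc k"] by (auto simp: Z_def)
  \<comment> \<open>The Pluecker relation splits the new factor in two. One piece adds the node
    \<open>Z\<close> to the j-th basis function; the other depends on \<open>j\<close> only through
    \<open>G Z j\<close>, and its sum is the induction hypothesis at \<open>Z\<close>.\<close>
  have step: "G y j * T W y = G y j * T W (z j) * (T Z y / T Z (z j)) + T W Z * (G Z j * (\<Prod>i\<le>k. T (z i) y / T (z i) Z))"
    if j: "j \<le> k" for j
  proof -
    have "T W y * T Z (z j) = T W Z * T y (z j) - T W (z j) * T y Z"
      by (rule pluecker) (use WZ z Suc.prems in auto)
    moreover have "T y Z = - T Z y" "T y (z j) = - T (z j) y" "T Z (z j) = - T (z j) Z"
      by (rule anti; use WZ Suc.prems z in blast)+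
    moreover have "X = E * (G / D) + B * (H / I)"
      if "X * D = B * y1 - E * y2" "y2 = - G" "y1 = - H" "D = - I" "D \<noteq> 0" for X D B y1 y2 E G H I :: 'b
    proof -
      have "X = (B * y1 - E * y2) / D" using that(1,5) by (simp add: eq_divide_eq)
      then show ?thesis using that by (simp add: diff_divide_distrib add_divide_distrib)
    qed
    ultimately have "T W y = T W (z j) * (T Z y / T Z (z j)) + T W Z * (T (z j) y / T (z j) Z)"
      using ZZ(1)[OF j] by blast
    moreover have "G Z j * (\<Prod>i\<le>k. T (z i) y / T (z i) Z) = G y j * (T (z j) y / T (z j) Z)"
    proof -
      have "(\<Prod>i\<le>k. T (z i) y / T (z i) Z) = T (z j) y / T (z j) Z * (\<Prod>i\<in>{..k} - {j}. T (z i) y / T (z i) Z)"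
        using j by (subst prod.remove[of _ j]) auto
      moreover have "(\<Prod>i\<in>{..k} - {j}. T (z i) Z / T (z i) (z j)) * (\<Prod>i\<in>{..k} - {j}. T (z i) y / T (z i) Z)
          = (\<Prod>i\<in>{..k} - {j}. T (z i) y / T (z i) (z j))"
        unfolding prod.distrib[symmetric] by (intro prod.cong refl) (use ZZ in auto)
      ultimately show ?thesis by (simp add: G_def mult_ac)
    qed
    ultimately show ?thesis by (simp add: algebra_simps)
  qed
  have "(\<Prod>i<Suc k. T (w i) y) = (\<Sum>j\<le>k. G y j * T W y)"
    using IH[OF Suc.prems] by (simp add: W_def sum_distrib_right)
  also have "\<dots> = (\<Sum>j\<le>k. G y j * T W (z j) * (T Z y / T Z (z j)) + T W Z * (G Z j * (\<Prod>i\<le>k. T (z i) y / T (z i) Z)))"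
    by (intro sum.cong refl step) auto
  also have "\<dots> = (\<Sum>j\<le>k. G y j * T W (z j) * (T Z y / T Z (z j))) + T W Z * ((\<Prod>i<k. T (w i) Z) * (\<Prod>i\<le>k. T (z i) y / T (z i) Z))"
    unfolding sum.distrib sum_distrib_left[symmetric] sum_distrib_right[symmetric] IH[OF WZ(2)] ..
  also have "T W Z * ((\<Prod>i<k. T (w i) Z) * (\<Prod>i\<le>k. T (z i) y / T (z i) Z))
      = (\<Prod>i<Suc k. T (w i) (z (Suc k))) * (\<Prod>i\<in>{..Suc k} - {Suc k}. T (z i) y / T (z i) (z (Suc k)))"
  proof -
    have "{..Suc k} - {Suc k} = {..k}" by auto
    then show ?thesis by (simp add: W_def Z_def mult_ac)
  qed
  also have "(\<Sum>j\<le>k. G y j * T W (z j) * (T Z y / T Z (z j)))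
      = (\<Sum>j\<le>k. (\<Prod>i<Suc k. T (w i) (z j)) * (\<Prod>i\<in>{..Suc k} - {j}. T (z i) y / T (z i) (z j)))"
  proof (rule sum.cong)
    fix j assume "j \<in> {..k}"
    then have "{..Suc k} - {j} = insert (Suc k) ({..k} - {j})" by auto
    then show "G y j * T W (z j) * (T Z y / T Z (z j))
        = (\<Prod>i<Suc k. T (w i) (z j)) * (\<Prod>i\<in>{..Suc k} - {j}. T (z i) y / T (z i) (z j))"
      by (simp add: G_def W_def Z_def)
  qed simp
  finally show ?case by simp
qed

context theta_base begin

text \<open>The interpolation nodes are \<open>d = aq\<^bsup>3j\<^esup>\<close>.\<close>

definition lagrange_coeff :: "complex \<Rightarrow> nat \<Rightarrow> nat \<Rightarrow> nat \<Rightarrow> complex" where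
  "lagrange_coeff a n k j = poch a (3 * int j) 1 k * poch 1 (int n + 1 - 3 * int j) 1 k
     / (\<Prod>i\<in>{..k} - {j}. th a (3 * int i + 3 * int j - int n - 1) * th 1 (3 * int i - 3 * int j))"

lemma de_expansion:
  assumes nz: "a \<noteq> 0" "d \<noteq> 0" "e \<noteq> 0" and de: "d * e = a * q ^ (n + 1)"
    and ga: "\<And>i. th a i \<noteq> 0" and gd: "\<And>i. th (a / d) i \<noteq> 0" and ge: "\<And>i. th (a / e) i \<noteq> 0"
    and g1: "\<And>i. i \<noteq> 0 \<Longrightarrow> th 1 i \<noteq> 0"
  shows "poch d 0 1 k * poch e 0 1 k / (poch (a / d) 3 3 k * poch (a / e) 3 3 k)
    = (\<Sum>j\<le>k. lagrange_coeff a n k j * (th (a / d) 0 * th (a / e) 0 / (th (a / d) (3 * int j) * th (a / e) (3 * int j))))"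
proof -
  define K where "K = d * e"
  define T where "T = ethe2 p K"
  \<comment> \<open>At the second point 1/e, the points \<open>w i\<close> produce the products in d
    and e. The nodes satisfy d z_i = (a/e) q^(3i) and e z_i = (a/d) q^(3i), which are the arguments
    of the denominator.\<close>
  define w where "w = (\<lambda>i::nat. q powi (int i))"
  define z where "z = (\<lambda>i::nat. q powi (3 * int i - int n - 1))"
  define H where "H = (\<lambda>i::nat. th (a / d) (3 * int i) * th (a / e) (3 * int i))"
  have K: "K = a * q powi (int n + 1)" using de by (simp add: K_def power_int_add q)
  have K0: "K \<noteq> 0" using nz by (simp add: K_def)
  have wz: "w i \<noteq> 0" "z i \<noteq> 0" for i using q by (simp_all add: w_def z_def)
  have thK: "th K i = th a (i + (int n + 1))" for i unfolding K th_shift ..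
  have Tq: "T (q powi s) (q powi t) = th a (s + t + int n + 1) * th 1 (s - t) / q powi s" for s t
    unfolding T_def ethe2_powi by (simp add: theta_base.ethe2_exp_def[OF theta_base_axioms] thK algebra_simps)
  have Twz: "T (w i) (z j) = th a (3 * int j + int i) * th 1 (int n + 1 - 3 * int j + int i) / w i" for i j
    unfolding w_def z_def Tq by (simp add: algebra_simps)
  have Tzz: "T (z i) (z j) = th a (3 * int i + 3 * int j - int n - 1) * th 1 (3 * int i - 3 * int j) / z i" for i j
    unfolding z_def Tq by (simp add: algebra_simps)
  have TF: "T t (1 / e) = ethe p (d * t) * ethe p (e * t) / t" for t
    using nz by (simp add: T_def ethe2_def K_def mult_ac)
  have Twy: "T (w i) (1 / e) = th d (int i) * th e (int i) / w i" for i
    unfolding TF w_def th_def ..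
  have Tzy: "T (z i) (1 / e) = H i / z i" for i
  proof -
    have "d * z i = a / e * q powi (3 * int i)" "e * z i = a / d * q powi (3 * int i)"
      using K nz q by (simp_all add: K_def z_def power_int_diff power_int_add field_simps)
    then show ?thesis unfolding TF H_def th_def by (simp add: mult_ac)
  qed
  have H0: "H i \<noteq> 0" for i using gd ge by (simp add: H_def)
  define c where "c = (\<lambda>i j::nat. th a (3 * int i + 3 * int j - int n - 1) * th 1 (3 * int i - 3 * int j))"
  have c0: "c i j \<noteq> 0" if "i \<noteq> j" for i j using that ga g1 by (simp add: c_def)
  have "(\<Prod>i<k. T (w i) (1 / e))
    = (\<Sum>j\<le>k. (\<Prod>i<k. T (w i) (z j)) * (\<Prod>i\<in>{..k} - {j}. T (z i) (1 / e) / T (z i) (z j)))"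
  proof (rule lagrange_pluecker[where X = "- {0}"])
    show "T (z i) (z j) \<noteq> 0" if "i \<noteq> j" for i j
      unfolding Tzz using that ga g1 wz by simp
  qed (use wz K0 nz in \<open>auto simp: T_def intro!: ethe2_antisym[OF p] ethe2_pluecker[OF p]\<close>)
  also have "(\<Prod>i<k. T (w i) (1 / e)) = poch d 0 1 k * poch e 0 1 k / (\<Prod>i<k. w i)"
    unfolding Twy poch_def by (simp add: prod.distrib prod_dividef)
  also have "(\<lambda>j. (\<Prod>i<k. T (w i) (z j)) * (\<Prod>i\<in>{..k} - {j}. T (z i) (1 / e) / T (z i) (z j)))
     = (\<lambda>j. poch a (3 * int j) 1 k * poch 1 (int n + 1 - 3 * int j) 1 k * (\<Prod>i\<in>{..k} - {j}. H i / c i j) / (\<Prod>i<k. w i))"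
    unfolding Twz Tzz Tzy poch_def using wz by (simp add: prod.distrib prod_dividef c_def mult_ac)
  finally have "poch d 0 1 k * poch e 0 1 k / (\<Prod>i<k. w i)
    = (\<Sum>j\<le>k. poch a (3 * int j) 1 k * poch 1 (int n + 1 - 3 * int j) 1 k * (\<Prod>i\<in>{..k} - {j}. H i / c i j)) / (\<Prod>i<k. w i)"
    by (simp add: sum_divide_distrib)
  then have "poch d 0 1 k * poch e 0 1 k
    = (\<Sum>j\<le>k. poch a (3 * int j) 1 k * poch 1 (int n + 1 - 3 * int j) 1 k * (\<Prod>i\<in>{..k} - {j}. H i / c i j))"
    using wz by simp
  \<comment> \<open>The product of \<open>H i\<close> over \<open>i \<noteq> j\<close> is the full
    denominator, which has the indices 1 to \<open>k\<close>, times
    \<open>H 0 / H j\<close>.\<close>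
  also have "\<dots> = (\<Sum>j\<le>k. lagrange_coeff a n k j * (H 0 / H j) * (poch (a / d) 3 3 k * poch (a / e) 3 3 k))"
  proof (rule sum.cong)
    fix j assume j: "j \<in> {..k}"
    have "H j * (\<Prod>i\<in>{..k} - {j}. H i) = (\<Prod>i\<le>k. H i)"
      using j by (subst prod.remove[of "{..k}" j]) auto
    also have "\<dots> = H 0 * (\<Prod>i<k. H (Suc i))"
      unfolding lessThan_Suc_atMost[symmetric] by (simp only: prod.lessThan_Suc_shift)
    also have "(\<Prod>i<k. H (Suc i)) = poch (a / d) 3 3 k * poch (a / e) 3 3 k"
      unfolding H_def poch_def by (simp add: prod.distrib algebra_simps)
    finally have "(\<Prod>i\<in>{..k} - {j}. H i) = H 0 / H j * (poch (a / d) 3 3 k * poch (a / e) 3 3 k)"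
      using H0[of j] by (simp add: field_simps)
    then show "poch a (3 * int j) 1 k * poch 1 (int n + 1 - 3 * int j) 1 k * (\<Prod>i\<in>{..k} - {j}. H i / c i j)
       = lagrange_coeff a n k j * (H 0 / H j) * (poch (a / d) 3 3 k * poch (a / e) 3 3 k)"
      unfolding lagrange_coeff_def by (simp add: prod_dividef c_def mult_ac)
  qed simp
  also have "\<dots> = (\<Sum>j\<le>k. lagrange_coeff a n k j * (H 0 / H j)) * (poch (a / d) 3 3 k * poch (a / e) 3 3 k)"
    by (simp add: sum_distrib_right)
  finally show ?thesis
    using poch_nonzero[of "a / d" 3 3 k, OF gd] poch_nonzero[of "a / e" 3 3 k, OF ge] by (simp add: H_def)
qed

section \<open>Exchange of the sums and comparison of coefficients\<close>

definition outer_term :: "nat \<Rightarrow> complex \<Rightarrow> complex \<Rightarrow> complex \<Rightarrow> nat \<Rightarrow> complex" where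
  "outer_term n a b c k = th a (4 * int k) / th a 0 * (poch b 0 3 k * poch c 0 3 k) / (poch (a / b) 1 1 k * poch (a / c) 1 1 k)
     * (poch 1 (- int n) 1 (2 * k) / poch a (int n + 1) 1 (2 * k)) * q ^ k"

text \<open>This is \<open>outer_term\<close> times \<open>lagrange_coeff\<close> at k = j, the
  lowest term of the inner sum; dividing it out normalises that sum to begin with 1.\<close>

definition shift_factor :: "nat \<Rightarrow> complex \<Rightarrow> complex \<Rightarrow> complex \<Rightarrow> nat \<Rightarrow> complex" where
  "shift_factor n a b c j = outer_term n a b c j * (poch a (3 * int j) 1 j * poch 1 (int n + 1 - 3 * int j) 1 j)
     / (poch a (3 * int j - int n - 1) 3 j * poch 1 (- 3 * int j) 3 j)"

lemma outer_lagrange: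
  assumes nz: "a \<noteq> 0" "b \<noteq> 0" "c \<noteq> 0" and ga: "\<And>i. th a i \<noteq> 0" and j: "2 * j \<le> n"
  shows "outer_term n a b c (j + m) * lagrange_coeff a n (j + m) j
    = shift_factor n a b c j * cubic_term (n - 2 * j) (a * q powi (4 * int j)) (b * q powi (3 * int j)) (c * q powi (3 * int j)) m"
proof -
  have n: "int (n - 2 * j) = int n - 2 * int j" using j by simp
  have ab: "a * q powi (4 * int j) / (b * q powi (3 * int j)) = a / b * q powi int j" for b
    using q power_int_diff[of q "4 * int j" "3 * int j"] by simp
  \<comment> \<open>The omitted index cuts the nodes in two: those below \<open>j\<close> do not
    involve \<open>m\<close>, those above give the last two denominator products of
    \<open>cubic_term\<close>.\<close>
  have D: "(\<Prod>i\<in>{..j + m} - {j}. th a (3 * int i + 3 * int j - int n - 1) * th 1 (3 * int i - 3 * int j))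
     = (poch a (3 * int j - int n - 1) 3 j * poch 1 (- 3 * int j) 3 j) * (poch a (6 * int j + 2 - int n) 3 m * poch 1 3 3 m)"
  proof -
    let ?f = "\<lambda>i. th a (3 * int i + 3 * int j - int n - 1) * th 1 (3 * int i - 3 * int j)"
    have "(\<Prod>i\<in>{..j + m} - {j}. ?f i) = (\<Prod>i\<in>{..<j}. ?f i) * (\<Prod>i\<in>{Suc j..<Suc j + m}. ?f i)"
      by (subst prod.union_disjoint[symmetric]) (auto intro!: prod.cong)
    also have "(\<Prod>i\<in>{Suc j..<Suc j + m}. ?f i) = (\<Prod>i<m. ?f (Suc j + i))"
      by (rule prod.reindex_bij_witness[where i = "\<lambda>i. Suc j + i" and j = "\<lambda>i. i - Suc j"]) auto
    also have "\<dots> = poch a (6 * int j + 2 - int n) 3 m * poch 1 3 3 m"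
      unfolding poch_def prod.distrib[symmetric] by (simp add: algebra_simps)
    also have "(\<Prod>i\<in>{..<j}. ?f i) = poch a (3 * int j - int n - 1) 3 j * poch 1 (- 3 * int j) 3 j"
      unfolding poch_def prod.distrib[symmetric] by (simp add: algebra_simps)
    finally show ?thesis .
  qed
  have S: "cubic_term (n - 2 * j) (a * q powi (4 * int j)) (b * q powi (3 * int j)) (c * q powi (3 * int j)) m
    = th a (4 * int (j + m)) / th a (4 * int j) * (poch b (3 * int j) 3 m * poch c (3 * int j) 3 m)
      / (poch (a / b) (1 + int j) 1 m * poch (a / c) (1 + int j) 1 m)
     * (poch 1 (- int n + int (2 * j)) 1 (2 * m) / poch a (int n + 1 + int (2 * j)) 1 (2 * m))
     * (poch a (4 * int j) 1 m * poch 1 (int n + 1 - 2 * int j) 1 m)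
     / (poch 1 3 3 m * poch a (6 * int j + 2 - int n) 3 m) * q ^ m"
    unfolding cubic_term_def ab th_shift poch_translate n by (simp add: algebra_simps)
  have split: "poch b 0 3 (j + m) = poch b 0 3 j * poch b (3 * int j) 3 m" "poch c 0 3 (j + m) = poch c 0 3 j * poch c (3 * int j) 3 m"
    "poch (a / b) 1 1 (j + m) = poch (a / b) 1 1 j * poch (a / b) (1 + int j) 1 m"
    "poch (a / c) 1 1 (j + m) = poch (a / c) 1 1 j * poch (a / c) (1 + int j) 1 m"
    "poch 1 (- int n) 1 (2 * (j + m)) = poch 1 (- int n) 1 (2 * j) * poch 1 (- int n + int (2 * j)) 1 (2 * m)"
    "poch a (int n + 1) 1 (2 * (j + m)) = poch a (int n + 1) 1 (2 * j) * poch a (int n + 1 + int (2 * j)) 1 (2 * m)"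
    "poch a (3 * int j) 1 (j + m) = poch a (3 * int j) 1 j * poch a (4 * int j) 1 m"
    "poch 1 (int n + 1 - 3 * int j) 1 (j + m) = poch 1 (int n + 1 - 3 * int j) 1 j * poch 1 (int n + 1 - 2 * int j) 1 m"
    by (simp_all add: poch_add distrib_left)
  show ?thesis
    unfolding lagrange_coeff_def D S shift_factor_def outer_term_def split power_add
    using ga[of "4 * int j"] by (simp add: mult_ac)
qed

text \<open>The summand of the series with a^2/(de) = a q^(-n-1). The numerator products at q^(2-n),
  q^(1-n), q^(-n) are merged into one of length 3j in base q, and likewise the three denominator
  products at a, aq, aq^2.\<close>

definition omega_term :: "nat \<Rightarrow> complex \<Rightarrow> complex \<Rightarrow> complex \<Rightarrow> complex \<Rightarrow> complex \<Rightarrow> nat \<Rightarrow> complex" where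
  "omega_term n a b c d e j = th a (6 * int j - int n - 1) / th a (- int n - 1)
     * (poch a (- int n - 1) 3 j * (poch b 0 3 j * poch c 0 3 j) * (poch (a / d) 0 3 j * poch (a / e) 0 3 j) * poch 1 (- int n) 1 (3 * j)) * q ^ (3 * j)
     / (poch 1 3 3 j * (poch (a / b) (2 - int n) 3 j * poch (a / c) (2 - int n) 3 j) * (poch (a / d) 3 3 j * poch (a / e) 3 3 j) * poch a 0 1 (3 * j))"

lemma powi_sum: "(\<Prod>i\<in>A. q powi f i) = q powi (\<Sum>i\<in>A. f i)"
  by (induction A rule: infinite_finite_induct) (simp_all add: power_int_add q)

lemma poch_reverse:
  assumes "\<And>i::nat. th y (l + s * int i) = h i * th x (l' + s * (int j - 1 - int i))"
  shows "poch y l s j = (\<Prod>i<j. h i) * poch x l' s j"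
proof -
  have "poch y l s j = (\<Prod>i<j. h i) * (\<Prod>i<j. th x (l' + s * (int j - 1 - int i)))"
    unfolding poch_def assms prod.distrib ..
  also have "(\<Prod>i<j. th x (l' + s * (int j - 1 - int i))) = (\<Prod>i<j. th x (l' + s * int (j - Suc i)))"
    by (intro prod.cong refl) (simp add: of_nat_diff algebra_simps)
  also have "\<dots> = poch x l' s j"
    unfolding poch_def by (rule prod.nat_diff_reindex)
  finally show ?thesis .
qed

text \<open>Each long product is cut at the places where a shorter one begins or ends, products at
  a/c are reversed into products at a/b, and everything cancels up to a power of q.\<close>

lemma shift_factor_prefactor:
  assumes nz: "a \<noteq> 0" "b \<noteq> 0" "c \<noteq> 0" and bc: "b * c = a ^ 2 * q ^ (n + 1)"
    and ga: "\<And>i. th a i \<noteq> 0" and gb: "\<And>i. th (a / b) i \<noteq> 0" and gd: "\<And>i. th (a / d) i \<noteq> 0" and ge: "\<And>i. th (a / e) i \<noteq> 0"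
    and g1: "\<And>i. i \<noteq> 0 \<Longrightarrow> th 1 i \<noteq> 0"
    and j: "3 * j \<le> n"
  shows "shift_factor n a b c j * prefactor (n - 2 * j) (a * q powi (4 * int j)) (b * q powi (3 * int j))
       * (th (a / d) 0 * th (a / e) 0 / (th (a / d) (3 * int j) * th (a / e) (3 * int j)))
    = prefactor n a b * omega_term n a b c d e j"
proof -
  have gc: "th (a / c) i \<noteq> 0" for i
    unfolding th_a_over_c[OF nz bc] using nz q gb by simp
  \<comment> \<open>Reversing the a/c products in base q^3 and in base q yields different monomials;
    \<open>\<kappa>\<close> is their quotient.\<close>
  define \<kappa> where "\<kappa> = (\<Prod>i<j. q powi (2 * int i + 1 - int n))"
  have n: "int (n - 2 * j) = int n - 2 * int j" using j by simp
  have ab: "a * q powi (4 * int j) / (b * q powi (3 * int j)) = a / b * q powi int j"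
    using q power_int_diff[of q "4 * int j" "3 * int j"] by simp
  have pre: "prefactor (n - 2 * j) (a * q powi (4 * int j)) (b * q powi (3 * int j))
    = poch a (4 * int j + 1) 1 (n - 2 * j) * poch (a / b) (3 * int j + 2 - int n) 3 (n - 2 * j)
     / (poch (a / b) (int j + 1) 1 (n - 2 * j) * poch a (6 * int j + 2 - int n) 3 (n - 2 * j))"
    unfolding prefactor_def ab poch_translate n by (simp add: algebra_simps)

  have B1: "poch (a / b) 1 1 n = poch (a / b) 1 1 j * poch (a / b) (int j + 1) 1 (n - 2 * j) * poch (a / b) (int n - int j + 1) 1 j"
  proof -
    have "n = j + ((n - 2 * j) + j)" using j by simp
    then have "poch (a / b) 1 1 n = poch (a / b) 1 1 (j + ((n - 2 * j) + j))" by simp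
    then show ?thesis unfolding poch_add n by (simp add: algebra_simps)
  qed
  have B3: "poch (a / b) (2 - int n) 3 n = poch (a / b) (2 - int n) 3 j * poch (a / b) (3 * int j + 2 - int n) 3 (n - 2 * j)
       * poch (a / b) (2 * int n + 2 - 3 * int j) 3 j"
  proof -
    have "n = j + ((n - 2 * j) + j)" using j by simp
    then have "poch (a / b) (2 - int n) 3 n = poch (a / b) (2 - int n) 3 (j + ((n - 2 * j) + j))" by simp
    then show ?thesis unfolding poch_add n by (simp add: algebra_simps)
  qed
  have C1: "poch (a / c) 1 1 j = (\<Prod>i<j. - (q powi (int i - int n) * b / a)) * poch (a / b) (int n - int j + 1) 1 j"
    by (rule poch_reverse) (simp add: th_a_over_c[OF nz bc] algebra_simps)
  have C3: "poch (a / c) (2 - int n) 3 j = (\<Prod>i<j. - (q powi (3 * int i + 1 - 2 * int n) * b / a)) * poch (a / b) (2 * int n + 2 - 3 * int j) 3 j"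
    by (rule poch_reverse) (simp add: th_a_over_c[OF nz bc] algebra_simps)
  have C31: "(\<Prod>i<j. - (q powi (3 * int i + 1 - 2 * int n) * b / a)) = \<kappa> * (\<Prod>i<j. - (q powi (int i - int n) * b / a))"
    unfolding \<kappa>_def prod.distrib[symmetric]
  proof (rule prod.cong)
    fix i
    have e: "3 * int i + 1 - 2 * int n = (2 * int i + 1 - int n) + (int i - int n)" by simp
    have "q powi (3 * int i + 1 - 2 * int n) = q powi (2 * int i + 1 - int n) * q powi (int i - int n)"
      by (subst e, rule power_int_add) (simp add: q)
    then show "- (q powi (3 * int i + 1 - 2 * int n) * b / a) = q powi (2 * int i + 1 - int n) * - (q powi (int i - int n) * b / a)"
      by simp
  qed simp

  \<comment> \<open>Both sides are (a; q, p)_(n+1+2j), cut at different places; \<open>A3\<close>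
    does the same for a product of n + 1 factors in base q^3.\<close>
  have A1: "th a 0 * poch a 1 1 n * poch a (int n + 1) 1 (2 * j)
      = poch a 0 1 (3 * j) * poch a (3 * int j) 1 j * th a (4 * int j) * poch a (4 * int j + 1) 1 (n - 2 * j)"
  proof -
    have "poch a 0 1 (Suc n + 2 * j) = th a 0 * poch a 1 1 n * poch a (int n + 1) 1 (2 * j)"
      unfolding poch_add by (simp add: poch_Suc_left algebra_simps)
    moreover have "Suc n + 2 * j = 3 * j + (j + Suc (n - 2 * j))" using j by simp
    then have "poch a 0 1 (Suc n + 2 * j) = poch a 0 1 (3 * j + (j + Suc (n - 2 * j)))" by (rule arg_cong)
    moreover have "\<dots> = poch a 0 1 (3 * j) * (poch a (3 * int j) 1 j * (th a (4 * int j) * poch a (4 * int j + 1) 1 (n - 2 * j)))"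
      unfolding poch_add poch_Suc_left by (simp add: algebra_simps)
    ultimately show ?thesis by (simp add: mult_ac)
  qed
  have A3: "th a (- int n - 1) * poch a (2 - int n) 3 n
      = poch a (- int n - 1) 3 j * poch a (3 * int j - int n - 1) 3 j * th a (6 * int j - int n - 1) * poch a (6 * int j + 2 - int n) 3 (n - 2 * j)"
  proof -
    have "poch a (- int n - 1) 3 (Suc n) = th a (- int n - 1) * poch a (2 - int n) 3 n"
      by (simp add: poch_Suc_left)
    moreover have "Suc n = j + (j + Suc (n - 2 * j))" using j by simp
    then have "poch a (- int n - 1) 3 (Suc n) = poch a (- int n - 1) 3 (j + (j + Suc (n - 2 * j)))" by (rule arg_cong)
    moreover have "\<dots> = poch a (- int n - 1) 3 j * (poch a (3 * int j - int n - 1) 3 j * (th a (6 * int j - int n - 1) * poch a (6 * int j + 2 - int n) 3 (n - 2 * j)))"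
      unfolding poch_add poch_Suc_left by (simp add: algebra_simps)
    ultimately show ?thesis by (simp add: mult_ac)
  qed

  have O1: "poch 1 (- int n) 1 (3 * j) = poch 1 (- int n) 1 (2 * j) * poch 1 (2 * int j - int n) 1 j"
  proof -
    have "3 * j = 2 * j + j" by simp
    then have "poch 1 (- int n) 1 (3 * j) = poch 1 (- int n) 1 (2 * j + j)" by simp
    then show ?thesis unfolding poch_add by (simp add: algebra_simps)
  qed
  have th1: "th 1 i = - (q powi i) * th 1 (- i)" for i
    using th_reflect[of 1 i] by simp
  have O2: "poch 1 (2 * int j - int n) 1 j = (\<Prod>i<j. - (q powi (2 * int j - int n + int i))) * poch 1 (int n + 1 - 3 * int j) 1 j"
    by (rule poch_reverse) (subst th1, simp add: algebra_simps)
  have O3: "poch 1 3 3 j = (\<Prod>i<j. - (q powi (3 + 3 * int i))) * poch 1 (- 3 * int j) 3 j"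
    by (rule poch_reverse) (subst th1, simp add: algebra_simps)
  have O4: "q ^ j * \<kappa> * (\<Prod>i<j. - (q powi (3 + 3 * int i))) = q ^ (3 * j) * (\<Prod>i<j. - (q powi (2 * int j - int n + int i)))"
  proof -
    \<comment> \<open>The exponents on the two sides differ by the sum of 4i + 2 - 2j over i < j,
      which is 2j^2 - 2j^2 = 0.\<close>
    have sq: "(\<Sum>i<m. 4 * int i + 2) = 2 * int m * int m" for m :: nat
      by (induction m) (auto simp: algebra_simps)
    have "(\<Sum>i<j. 1 + (2 * int i + 1 - int n) + (3 + 3 * int i)) - (\<Sum>i<j. 3 + (2 * int j - int n + int i)) = (\<Sum>i<j. (4 * int i + 2) - 2 * int j)"
      unfolding sum_subtractf[symmetric] by (intro sum.cong) auto
    also have "\<dots> = 0" unfolding sum_subtractf sq by simp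
    finally have e: "(\<Sum>i<j. 1 + (2 * int i + 1 - int n) + (3 + 3 * int i)) = (\<Sum>i<j. 3 + (2 * int j - int n + int i))" by simp
    have "q ^ j * \<kappa> * (\<Prod>i<j. - (q powi (3 + 3 * int i))) = (- 1) ^ j * (\<Prod>i<j. q powi (1 + (2 * int i + 1 - int n) + (3 + 3 * int i)))"
    proof -
      have "(\<Prod>i<j. q powi (1 + (2 * int i + 1 - int n) + (3 + 3 * int i)))
          = (\<Prod>i<j. q * q powi (2 * int i + 1 - int n) * q powi (3 + 3 * int i))"
        using q by (intro prod.cong refl) (simp only: power_int_add power_int_1_right simp_thms)
      then show ?thesis by (simp add: \<kappa>_def prod.distrib prod_uminus)
    qed
    also have "\<dots> = (- 1) ^ j * (\<Prod>i<j. q powi (3 + (2 * int j - int n + int i)))"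
      unfolding powi_sum e ..
    also have "\<dots> = q ^ (3 * j) * (\<Prod>i<j. - (q powi (2 * int j - int n + int i)))"
    proof -
      have "(\<Prod>i<j. q powi (3 + (2 * int j - int n + int i))) = (\<Prod>i<j. q ^ 3 * q powi (2 * int j - int n + int i))"
        using q by (intro prod.cong refl) (simp only: power_int_add power_int_numeral simp_thms)
      then show ?thesis by (simp add: prod.distrib prod_uminus power_mult)
    qed
    finally show ?thesis .
  qed

  have Dd: "poch (a / d) 0 3 j = th (a / d) 0 * poch (a / d) 3 3 j / th (a / d) (3 * int j)"
    using poch_shift[of "a / d" 0 3 j] gd by (simp add: field_simps)
  have De: "poch (a / e) 0 3 j = th (a / e) 0 * poch (a / e) 3 3 j / th (a / e) (3 * int j)"
    using poch_shift[of "a / e" 0 3 j] ge by (simp add: field_simps)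
  define R1 where "R1 = (\<Prod>i<j. - (q powi (int i - int n) * b / a))"
  define R2 where "R2 = (\<Prod>i<j. - (q powi (2 * int j - int n + int i)))"
  define R3 where "R3 = (\<Prod>i<j. - (q powi (3 + 3 * int i)))"
  have R: "R1 \<noteq> 0" "R2 \<noteq> 0" "R3 \<noteq> 0" "\<kappa> \<noteq> 0" using nz q by (simp_all add: R1_def R2_def R3_def \<kappa>_def)
  have A1': "poch a 1 1 n = poch a 0 1 (3 * j) * poch a (3 * int j) 1 j * th a (4 * int j) * poch a (4 * int j + 1) 1 (n - 2 * j)
      / (th a 0 * poch a (int n + 1) 1 (2 * j))"
    using A1 ga poch_nonzero[OF ga] by (simp add: field_simps)
  have A3': "poch a (2 - int n) 3 n = poch a (- int n - 1) 3 j * poch a (3 * int j - int n - 1) 3 j * th a (6 * int j - int n - 1) * poch a (6 * int j + 2 - int n) 3 (n - 2 * j)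
     / th a (- int n - 1)"
    using A3 ga by (simp add: field_simps)
  have O4': "q ^ (3 * j) = q ^ j * \<kappa> * R3 / R2"
    using O4 R unfolding R2_def R3_def by (simp add: field_simps)
  have O3': "poch 1 (- 3 * int j) 3 j \<noteq> 0" "poch 1 3 3 j \<noteq> 0"
    using g1 by (simp_all add: poch_def)
  have clear: "A4 / A0 * bc / (B1 * (R1 * Bn)) * (o2 / An) * Q * (A3 * o4) / (X1 * o5)
      * (A41 * B2 / (B3 * X2)) * (D0 * E0 / (D3 * E3))
    = (Z * A3 * A4 * A41 / (A0 * An)) * (B4 * B2 * B5) / ((B1 * B3 * Bn) * (Y * X1 * Y6 * X2 / Y1))
      * (Y6 / Y1 * (Y * bc * ((D0 * PD / D3) * (E0 * PE / E3)) * (o2 * (R2 * o4))) * (Q * \<kappa> * R3 / R2)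
       / (R3 * o5 * (B4 * (\<kappa> * R1 * B5)) * (PD * PE) * Z))"
    if "A0 \<noteq> 0" "A4 \<noteq> 0" "B1 \<noteq> 0" "Bn \<noteq> 0" "An \<noteq> 0" "X1 \<noteq> 0" "o5 \<noteq> 0" "B3 \<noteq> 0" "X2 \<noteq> 0" "D0 \<noteq> 0" "E0 \<noteq> 0" "D3 \<noteq> 0" "E3 \<noteq> 0"
      "Z \<noteq> 0" "B4 \<noteq> 0" "B5 \<noteq> 0" "Y \<noteq> 0" "Y6 \<noteq> 0" "Y1 \<noteq> 0" "PD \<noteq> 0" "PE \<noteq> 0"
    for A0 A4 bc B1 Bn o2 An Q A3 o4 X1 o5 A41 B2 B3 X2 D0 E0 D3 E3 Z B4 B5 Y Y6 Y1 PD PE :: complex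
    using that R by (simp add: divide_simps)
  show ?thesis
    unfolding shift_factor_def outer_term_def pre omega_term_def Dd De O1 O2 O3 C1 C3 C31
    unfolding R1_def[symmetric] R2_def[symmetric] R3_def[symmetric] O4'
    unfolding prefactor_def A1' A3' B1 B3
    by (rule clear) (use ga gb gd ge poch_nonzero[OF ga] poch_nonzero[OF gb] poch_nonzero[OF gd] poch_nonzero[OF ge] O3' in auto)
qed

text \<open>The product starting at q^(n+1-3j) has exponents up to n - 2j, so it passes through
  exponent 0. This cuts the range of \<open>j\<close> down to that of the terminating
  series.\<close>

lemma shift_factor_vanish:
  assumes "3 * j > n" "2 * j \<le> n"
  shows "shift_factor n a b c j = 0"
proof -
  have "th 1 (int n + 1 - 3 * int j + 1 * int (3 * j - n - 1)) = 0"
    using assms th_1_0 by (simp add: of_nat_diff)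
  moreover have "3 * j - n - 1 < j" using assms by simp
  ultimately have "poch 1 (int n + 1 - 3 * int j) 1 j = 0"
    unfolding poch_def by (intro prod_zero) auto
  then show ?thesis by (simp add: shift_factor_def)
qed

definition lhs_term :: "nat \<Rightarrow> complex \<Rightarrow> complex \<Rightarrow> complex \<Rightarrow> complex \<Rightarrow> complex \<Rightarrow> nat \<Rightarrow> complex" where
  "lhs_term n a b c d e k = outer_term n a b c k * (poch d 0 1 k * poch e 0 1 k / (poch (a / d) 3 3 k * poch (a / e) 3 3 k))"

lemma generic_transformation:
  assumes nz: "a \<noteq> 0" "b \<noteq> 0" "c \<noteq> 0" "d \<noteq> 0" "e \<noteq> 0" and bc: "b * c = a ^ 2 * q ^ (n + 1)" and de: "d * e = a * q ^ (n + 1)"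
    and ga: "\<And>i. th a i \<noteq> 0" and gb: "\<And>i. th (a / b) i \<noteq> 0" and gd: "\<And>i. th (a / d) i \<noteq> 0" and ge: "\<And>i. th (a / e) i \<noteq> 0"
    and g1: "\<And>i. i \<noteq> 0 \<Longrightarrow> th 1 i \<noteq> 0"
  shows "(\<Sum>k\<le>n div 2. lhs_term n a b c d e k) = prefactor n a b * (\<Sum>j\<le>n div 3. omega_term n a b c d e j)"
proof -
  define N where "N = n div 2"
  define g where "g = (\<lambda>j. th (a / d) 0 * th (a / e) 0 / (th (a / d) (3 * int j) * th (a / e) (3 * int j)))"
  have "(\<Sum>k\<le>N. lhs_term n a b c d e k) = (\<Sum>k\<le>N. \<Sum>j\<le>k. outer_term n a b c k * lagrange_coeff a n k j * g j)"
  proof (rule sum.cong)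
    fix k
    show "lhs_term n a b c d e k = (\<Sum>j\<le>k. outer_term n a b c k * lagrange_coeff a n k j * g j)"
      using de_expansion[of a d e n k] nz de ga gd ge g1
      by (simp add: lhs_term_def g_def sum_distrib_left mult.assoc)
  qed simp
  \<comment> \<open>The triangle \<open>j \<le> k\<close> is summed along k = j + m.\<close>
  also have "\<dots> = (\<Sum>j\<le>N. \<Sum>m\<le>N - j. outer_term n a b c (j + m) * lagrange_coeff a n (j + m) j * g j)"
  proof -
    have "(\<Sum>k\<le>N. \<Sum>j\<le>k. f k j) = (\<Sum>j\<le>N. \<Sum>m\<le>N - j. f (j + m) j)" for f :: "nat \<Rightarrow> nat \<Rightarrow> complex"
      unfolding sum.Sigma[OF finite_atMost ballI[OF finite_atMost]]
      by (rule sum.reindex_bij_witness[where i = "\<lambda>(j, m). (j + m, j)" and j = "\<lambda>(k, j). (j, k - j)"]) auto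
    then show ?thesis .
  qed
  also have "\<dots> = (\<Sum>j\<le>N. shift_factor n a b c j * prefactor (n - 2 * j) (a * q powi (4 * int j)) (b * q powi (3 * int j)) * g j)"
  proof (rule sum.cong)
    fix j assume "j \<in> {..N}"
    then have j: "2 * j \<le> n" by (auto simp: N_def)
    define a' b' c' where "a' = a * q powi (4 * int j)" and "b' = b * q powi (3 * int j)" and "c' = c * q powi (3 * int j)"
    have ab: "a' / b' = a / b * q powi int j"
      using q power_int_diff[of q "4 * int j" "3 * int j"] by (simp add: a'_def b'_def)
    \<comment> \<open>The inner sum has exactly the length of the cubic sum for n - 2j.\<close>
    have Nj: "N - j = (n - 2 * j) div 2" by (simp add: N_def)
    have "(\<Sum>m\<le>N - j. outer_term n a b c (j + m) * lagrange_coeff a n (j + m) j * g j) = shift_factor n a b c j * g j * (\<Sum>m\<le>N - j. cubic_term (n - 2 * j) a' b' c' m)"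
      unfolding outer_lagrange[OF nz(1-3) ga j] a'_def b'_def c'_def by (simp add: sum_distrib_left mult_ac)
    also have "(\<Sum>m\<le>N - j. cubic_term (n - 2 * j) a' b' c' m) = prefactor (n - 2 * j) a' b'"
      unfolding Nj
    proof (rule cubic_sum)
      have "b' * c' = (b * c) * (q powi (3 * int j) * q powi (3 * int j))" by (simp add: b'_def c'_def mult_ac)
      also have "\<dots> = a ^ 2 * q powi (int n + 1) * (q powi (3 * int j) * q powi (3 * int j))"
        unfolding bc using q by (simp add: power_int_add)
      also have "\<dots> = a ^ 2 * q powi (int n + 1 + 3 * int j + 3 * int j)"
        using q by (simp only: power_int_add mult.assoc simp_thms)
      also have "int n + 1 + 3 * int j + 3 * int j = 4 * int j + 4 * int j + int (n - 2 * j + 1)"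
        using j by simp
      also have "q powi \<dots> = q powi (4 * int j) * q powi (4 * int j) * q ^ (n - 2 * j + 1)"
        using q by (simp only: power_int_add power_int_of_nat simp_thms)
      finally show "b' * c' = a'\<^sup>2 * q ^ (n - 2 * j + 1)" by (simp add: a'_def power2_eq_square mult_ac)
      show "th a' i \<noteq> 0" "th (a' / b') i \<noteq> 0" for i
        unfolding ab unfolding a'_def th_shift using ga gb by auto
    qed (use nz q g1 in \<open>auto simp: a'_def b'_def c'_def\<close>)
    finally show "(\<Sum>m\<le>N - j. outer_term n a b c (j + m) * lagrange_coeff a n (j + m) j * g j)
        = shift_factor n a b c j * prefactor (n - 2 * j) (a * q powi (4 * int j)) (b * q powi (3 * int j)) * g j"
      by (simp add: a'_def b'_def)
  qed simp
  also have "\<dots> = (\<Sum>j\<le>n div 3. shift_factor n a b c j * prefactor (n - 2 * j) (a * q powi (4 * int j)) (b * q powi (3 * int j)) * g j)"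
    by (rule sum.mono_neutral_right) (auto simp: N_def shift_factor_vanish)
  also have "\<dots> = (\<Sum>j\<le>n div 3. prefactor n a b * omega_term n a b c d e j)"
    unfolding g_def by (intro sum.cong refl shift_factor_prefactor nz bc ga gb gd ge g1) auto
  finally show ?thesis by (simp add: N_def sum_distrib_left)
qed

end

section \<open>Removing genericity\<close>

lemma avoid_countable:
  fixes x :: complex
  assumes "countable S" "\<epsilon> > 0"
  shows "\<exists>y. dist y x < \<epsilon> \<and> y \<notin> S"
proof -
  have "\<not> ball x \<epsilon> \<subseteq> S"
    using assms uncountable_ball[of \<epsilon> x] countable_subset by blast
  then show ?thesis by (auto simp: dist_commute)
qed

text \<open>For each zero z and each exponent the equation has finitely many roots; a negative
  exponent is replaced by its absolute value and z by 1/z.\<close>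

lemma (in theta_base) countable_powi_zeros: "countable {x. x \<noteq> 0 \<and> (\<exists>m\<noteq>0. ethe p (x powi m) = 0)}"
proof -
  define Z where "Z = {x. x \<noteq> 0 \<and> ethe p x = 0}"
  have Z: "countable Z" unfolding Z_def by (rule countable_ethe_zeros[OF p])
  have "{x. x \<noteq> 0 \<and> (\<exists>m\<noteq>0. ethe p (x powi m) = 0)}
     \<subseteq> (\<Union>z\<in>Z. \<Union>k\<in>{0::nat<..}. {x. x ^ k = z} \<union> {x. x ^ k = 1 / z})"
  proof
    fix x assume "x \<in> {x. x \<noteq> 0 \<and> (\<exists>m\<noteq>0. ethe p (x powi m) = 0)}"
    then obtain m where m: "x \<noteq> 0" "m \<noteq> 0" "ethe p (x powi m) = 0" by blast
    then have "x powi m \<in> Z" "nat \<bar>m\<bar> \<in> {0<..}" by (auto simp: Z_def)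
    moreover have "x ^ nat \<bar>m\<bar> = x powi m \<or> x ^ nat \<bar>m\<bar> = 1 / (x powi m)"
      using m by (cases "m > 0") (auto simp: power_int_def field_simps)
    ultimately show "x \<in> (\<Union>z\<in>Z. \<Union>k\<in>{0::nat<..}. {x. x ^ k = z} \<union> {x. x ^ k = 1 / z})" by blast
  qed
  moreover have "countable (\<Union>z\<in>Z. \<Union>k\<in>{0::nat<..}. {x. x ^ k = z} \<union> {x. x ^ k = 1 / z})"
  proof (intro countable_UN Z countableI_type)
    fix z and k :: nat assume "k \<in> {0<..}"
    then show "countable ({x. x ^ k = z} \<union> {x :: complex. x ^ k = 1 / z})"
      by (intro countable_finite) (auto intro: finite_nth_roots)
  qed
  ultimately show ?thesis by (rule countable_subset)
qed

text \<open>The values are chosen in the order Q, A, B, D, each outside a countable set determined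
  by the previous choices. The last condition, on D itself, takes care of a/e, which equals d
  q^(-n-1).\<close>

lemma generic_nearby:
  fixes p q a b d :: complex
  assumes p: "norm p < 1" and eps: "\<epsilon> > 0"
  shows "\<exists>Q A B D. dist Q q < \<epsilon> \<and> dist A a < \<epsilon> \<and> dist B b < \<epsilon> \<and> dist D d < \<epsilon>
    \<and> Q \<noteq> 0 \<and> A \<noteq> 0 \<and> B \<noteq> 0 \<and> D \<noteq> 0 \<and> (\<forall>m\<noteq>0. ethe p (Q powi m) \<noteq> 0)
    \<and> (\<forall>m. ethe p (A * Q powi m) \<noteq> 0 \<and> ethe p (A / B * Q powi m) \<noteq> 0
         \<and> ethe p (A / D * Q powi m) \<noteq> 0 \<and> ethe p (D * Q powi m) \<noteq> 0)"
proof -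
  \<comment> \<open>The base 1 is a dummy: the set in \<open>countable_powi_zeros\<close> involves
    only \<open>p\<close>.\<close>
  interpret theta_base p 1 using p by unfold_locales auto
  define Z where "Z = {x. x \<noteq> 0 \<and> ethe p x = 0}"
  have Z: "countable Z" unfolding Z_def by (rule countable_ethe_zeros[OF p])
  have notZ: "ethe p x \<noteq> 0" if "x \<notin> Z" "x \<noteq> 0" for x using that by (simp add: Z_def)
  define SQ where "SQ = insert 0 {x. x \<noteq> 0 \<and> (\<exists>m\<noteq>0. ethe p (x powi m) = 0)}"
  have "countable SQ" unfolding SQ_def by (intro countable_insert countable_powi_zeros)
  then obtain Q where Q: "dist Q q < \<epsilon>" "Q \<notin> SQ"
    using avoid_countable[OF _ eps] by blast
  have Q0: "Q powi m \<noteq> 0" for m using Q(2) by (simp add: SQ_def)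
  define SA where "SA = insert 0 (\<Union>m. (\<lambda>z. z / Q powi m) ` Z)"
  have "countable SA" unfolding SA_def using Z by (intro countable_insert countable_UN countable_image) auto
  then obtain A where A: "dist A a < \<epsilon>" "A \<notin> SA"
    using avoid_countable[OF _ eps] by blast
  define SB where "SB = insert 0 (\<Union>m. (\<lambda>z. A * Q powi m / z) ` Z)"
  have "countable SB" unfolding SB_def using Z by (intro countable_insert countable_UN countable_image) auto
  then obtain B where B: "dist B b < \<epsilon>" "B \<notin> SB"
    using avoid_countable[OF _ eps] by blast
  have "countable (SA \<union> SB)" using \<open>countable SA\<close> \<open>countable SB\<close> by (rule countable_Un)
  then obtain D where D: "dist D d < \<epsilon>" "D \<notin> SA \<union> SB"
    using avoid_countable[OF _ eps] by blast
  have nz: "A \<noteq> 0" "B \<noteq> 0" "D \<noteq> 0" using A(2) B(2) D(2) by (auto simp: SA_def SB_def)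
  have mult: "ethe p (x * Q powi m) \<noteq> 0" if x: "x \<notin> SA" "x \<noteq> 0" for x m
  proof (rule notZ)
    show "x * Q powi m \<notin> Z"
    proof
      assume "x * Q powi m \<in> Z"
      moreover have "x = x * Q powi m / Q powi m" using Q0[of m] by simp
      ultimately show False using x(1) unfolding SA_def by blast
    qed
    show "x * Q powi m \<noteq> 0" using x(2) Q0[of m] by simp
  qed
  have quot: "ethe p (A / x * Q powi m) \<noteq> 0" if x: "x \<notin> SB" "x \<noteq> 0" for x m
  proof (rule notZ)
    show "A / x * Q powi m \<notin> Z"
    proof
      assume "A / x * Q powi m \<in> Z"
      moreover have "x = A * Q powi m / (A / x * Q powi m)" using Q0[of m] nz x by simp
      ultimately show False using x(1) unfolding SB_def by blast
    qed
    show "A / x * Q powi m \<noteq> 0" using x(2) nz Q0[of m] by simp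
  qed
  have "\<forall>m\<noteq>0. ethe p (Q powi m) \<noteq> 0" "Q \<noteq> 0" using Q(2) by (auto simp: SQ_def)
  moreover have "\<forall>m. ethe p (A * Q powi m) \<noteq> 0 \<and> ethe p (A / B * Q powi m) \<noteq> 0
         \<and> ethe p (A / D * Q powi m) \<noteq> 0 \<and> ethe p (D * Q powi m) \<noteq> 0"
    using mult[OF A(2)] quot[OF B(2)] quot[of D] mult[of D] D(2) nz by simp
  ultimately show ?thesis using Q(1) A(1) B(1) D(1) nz by blast
qed

lemma generic_sequence:
  fixes p q a b d :: complex
  assumes p: "norm p < 1"
  obtains Q A B D :: "nat \<Rightarrow> complex" where
    "Q \<longlonglongrightarrow> q" "A \<longlonglongrightarrow> a" "B \<longlonglongrightarrow> b" "D \<longlonglongrightarrow> d"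
    "\<And>i. Q i \<noteq> 0" "\<And>i. A i \<noteq> 0" "\<And>i. B i \<noteq> 0" "\<And>i. D i \<noteq> 0"
    "\<And>i m. m \<noteq> 0 \<Longrightarrow> ethe p (Q i powi m) \<noteq> 0" "\<And>i m. ethe p (A i * Q i powi m) \<noteq> 0"
    "\<And>i m. ethe p (A i / B i * Q i powi m) \<noteq> 0" "\<And>i m. ethe p (A i / D i * Q i powi m) \<noteq> 0"
    "\<And>i m. ethe p (D i * Q i powi m) \<noteq> 0"
proof -
  have "\<forall>i::nat. \<exists>Q A B D. dist Q q < 1 / Suc i \<and> dist A a < 1 / Suc i \<and> dist B b < 1 / Suc i \<and> dist D d < 1 / Suc i
    \<and> Q \<noteq> 0 \<and> A \<noteq> 0 \<and> B \<noteq> 0 \<and> D \<noteq> 0 \<and> (\<forall>m\<noteq>0. ethe p (Q powi m) \<noteq> 0)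
    \<and> (\<forall>m. ethe p (A * Q powi m) \<noteq> 0 \<and> ethe p (A / B * Q powi m) \<noteq> 0
         \<and> ethe p (A / D * Q powi m) \<noteq> 0 \<and> ethe p (D * Q powi m) \<noteq> 0)"
    by (intro allI generic_nearby p) simp
  then obtain Q A B D where *: "\<And>i::nat. dist (Q i) q < 1 / Suc i \<and> dist (A i) a < 1 / Suc i \<and> dist (B i) b < 1 / Suc i \<and> dist (D i) d < 1 / Suc i
    \<and> Q i \<noteq> 0 \<and> A i \<noteq> 0 \<and> B i \<noteq> 0 \<and> D i \<noteq> 0 \<and> (\<forall>m\<noteq>0. ethe p (Q i powi m) \<noteq> 0)
    \<and> (\<forall>m. ethe p (A i * Q i powi m) \<noteq> 0 \<and> ethe p (A i / B i * Q i powi m) \<noteq> 0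
         \<and> ethe p (A i / D i * Q i powi m) \<noteq> 0 \<and> ethe p (D i * Q i powi m) \<noteq> 0)"
    by metis
  have lim: "X \<longlonglongrightarrow> x" if "\<And>i. dist (X i) x < 1 / Suc i" for X :: "nat \<Rightarrow> complex" and x
  proof (rule tendsto_dist_iff[THEN iffD2], rule tendsto_sandwich[OF _ _ tendsto_const])
    show "(\<lambda>i. 1 / real (Suc i)) \<longlonglongrightarrow> 0" using LIMSEQ_Suc[OF lim_1_over_n] by simp
    show "\<forall>\<^sub>F i in sequentially. dist (X i) x \<le> 1 / real (Suc i)"
      using that by (intro always_eventually allI less_imp_le) auto
  qed auto
  show thesis
    by (rule that[of Q A B D]; (rule lim)?; use * in blast)
qed

section \<open>Passage to the limit, with the base varying too\<close>

lemma tendsto_poch: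
  assumes p: "norm p < 1" and q: "q \<noteq> 0" and x: "x \<noteq> 0"
    and Q: "\<And>i. Q i \<noteq> 0" "(Q \<longlongrightarrow> q) F" and X: "(X \<longlongrightarrow> x) F"
  shows "((\<lambda>i. theta_base.th p (Q i) (X i) m) \<longlongrightarrow> theta_base.th p q x m) F"
    and "((\<lambda>i. theta_base.poch p (Q i) (X i) l s k) \<longlongrightarrow> theta_base.poch p q x l s k) F"
proof -
  have tb: "theta_base p q" "theta_base p (Q i)" for i
    using p q Q by unfold_locales auto
  show th: "((\<lambda>i. theta_base.th p (Q i) (X i) m) \<longlongrightarrow> theta_base.th p q x m) F" for m
    unfolding theta_base.th_def[OF tb(1)] theta_base.th_def[OF tb(2)]
    using q x by (intro tendsto_intros p Q X) auto
  show "((\<lambda>i. theta_base.poch p (Q i) (X i) l s k) \<longlongrightarrow> theta_base.poch p q x l s k) F"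
    unfolding theta_base.poch_def[OF tb(1)] theta_base.poch_def[OF tb(2)]
    by (intro tendsto_prod th)
qed

text \<open>Only denominators occurring in the two finite sums and the prefactor are assumed
  nonzero, which is what continuity at the given point needs; the identity itself is carried over
  from generic parameters.\<close>

lemma (in theta_base) transformation:
  assumes nz: "a \<noteq> 0" "b \<noteq> 0" "c \<noteq> 0" "d \<noteq> 0" "e \<noteq> 0"
    and bc: "b * c = a ^ 2 * q ^ (n + 1)" and de: "d * e = a * q ^ (n + 1)"
    and gen1: "th a 0 \<noteq> 0"
    and gen2: "\<And>k. k \<le> n div 2 \<Longrightarrow> poch (a / b) 1 1 k \<noteq> 0 \<and> poch (a / c) 1 1 k \<noteq> 0 \<and> poch a (int n + 1) 1 (2 * k) \<noteq> 0
       \<and> poch (a / d) 3 3 k \<noteq> 0 \<and> poch (a / e) 3 3 k \<noteq> 0"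
    and gen3: "poch (a / b) 1 1 n \<noteq> 0" "poch a (2 - int n) 3 n \<noteq> 0" "th a (- int n - 1) \<noteq> 0"
    and gen4: "\<And>j. j \<le> n div 3 \<Longrightarrow> poch 1 3 3 j \<noteq> 0 \<and> poch (a / b) (2 - int n) 3 j \<noteq> 0 \<and> poch (a / c) (2 - int n) 3 j \<noteq> 0
       \<and> poch (a / d) 3 3 j \<noteq> 0 \<and> poch (a / e) 3 3 j \<noteq> 0 \<and> poch a 0 1 (3 * j) \<noteq> 0"
  shows "(\<Sum>k\<le>n div 2. lhs_term n a b c d e k) = prefactor n a b * (\<Sum>j\<le>n div 3. omega_term n a b c d e j)"
proof -
  obtain Q A B D :: "nat \<Rightarrow> complex" where
    lim: "Q \<longlonglongrightarrow> q" "A \<longlonglongrightarrow> a" "B \<longlonglongrightarrow> b" "D \<longlonglongrightarrow> d"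
    and nz': "\<And>i. Q i \<noteq> 0" "\<And>i. A i \<noteq> 0" "\<And>i. B i \<noteq> 0" "\<And>i. D i \<noteq> 0"
    and gen: "\<And>i m. m \<noteq> 0 \<Longrightarrow> ethe p (Q i powi m) \<noteq> 0" "\<And>i m. ethe p (A i * Q i powi m) \<noteq> 0"
    "\<And>i m. ethe p (A i / B i * Q i powi m) \<noteq> 0" "\<And>i m. ethe p (A i / D i * Q i powi m) \<noteq> 0"
    "\<And>i m. ethe p (D i * Q i powi m) \<noteq> 0"
    using generic_sequence[OF p] by blast
  \<comment> \<open>\<open>C\<close> and \<open>E\<close> are solved from the constraints, so every
    approximation satisfies them exactly.\<close>
  define C E where "C = (\<lambda>i. (A i)\<^sup>2 * Q i ^ (n + 1) / B i)" and "E = (\<lambda>i. A i * Q i ^ (n + 1) / D i)"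
  have "c = a\<^sup>2 * q ^ (n + 1) / b" "e = a * q ^ (n + 1) / d"
    using bc de nz by (simp_all add: field_simps)
  then have limC: "C \<longlonglongrightarrow> c" and limE: "E \<longlonglongrightarrow> e"
    unfolding C_def E_def by (auto intro!: tendsto_intros lim nz)
  have tb: "theta_base p q" "theta_base p (Q i)" for i
    using p q nz' by unfold_locales auto
  note tendsto_pc = tendsto_poch[OF p q _ nz'(1) lim(1)]
  have eq: "(\<Sum>k\<le>n div 2. theta_base.lhs_term p (Q i) n (A i) (B i) (C i) (D i) (E i) k)
     = theta_base.prefactor p (Q i) n (A i) (B i) * (\<Sum>j\<le>n div 3. theta_base.omega_term p (Q i) n (A i) (B i) (C i) (D i) (E i) j)" for i
  proof (rule theta_base.generic_transformation[OF tb(2)])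
    have "A i / E i = D i * Q i powi (- int n - 1)"
      using nz'[of i] by (simp add: E_def power_int_diff power_int_minus field_simps)
    then have "theta_base.th p (Q i) (A i / E i) m = theta_base.th p (Q i) (D i) (m + (- int n - 1))" for m
      by (simp only: theta_base.th_shift[OF tb(2)])
    then show "theta_base.th p (Q i) (A i / E i) m \<noteq> 0" for m
      by (simp only: theta_base.th_def[OF tb(2)] gen(5) not_False_eq_True)
  qed (use nz' gen in \<open>auto simp: C_def E_def theta_base.th_def[OF tb(2)]\<close>)
  have limL: "(\<lambda>i. \<Sum>k\<le>n div 2. theta_base.lhs_term p (Q i) n (A i) (B i) (C i) (D i) (E i) k)
     \<longlonglongrightarrow> (\<Sum>k\<le>n div 2. lhs_term n a b c d e k)"
    unfolding lhs_term_def outer_term_def theta_base.lhs_term_def[OF tb(2)] theta_base.outer_term_def[OF tb(2)]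
    using gen1 gen2 nz
    by (intro tendsto_sum tendsto_intros tendsto_pc lim limC limE) auto
  have limR: "(\<lambda>i. theta_base.prefactor p (Q i) n (A i) (B i) * (\<Sum>j\<le>n div 3. theta_base.omega_term p (Q i) n (A i) (B i) (C i) (D i) (E i) j))
     \<longlonglongrightarrow> prefactor n a b * (\<Sum>j\<le>n div 3. omega_term n a b c d e j)"
    unfolding prefactor_def omega_term_def theta_base.prefactor_def[OF tb(2)] theta_base.omega_term_def[OF tb(2)]
    using gen3 gen4 nz
    by (intro tendsto_sum tendsto_intros tendsto_pc lim limC limE) auto
  show ?thesis
    by (rule LIMSEQ_unique[OF limL[unfolded eq] limR])
qed

section \<open>Translation to the notation of the theorem\<close>

lemma (in theta_base) tpoch_eq_poch: "tpoch (q ^ s) p (x * q powi l) (int k) = poch x l (int s) k"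
proof -
  have "q powi l * (q ^ s) ^ i = q powi (l + int s * int i)" for i
    using q by (simp add: power_int_add power_mult[symmetric] flip: of_nat_mult)
  then show ?thesis by (simp add: tpoch_def poch_def th_def mult.assoc)
qed

text \<open>Three progressions of step 3 interlace to one of step 1.\<close>

lemma (in theta_base) poch_triple: "poch x l 3 k * poch x (l + 1) 3 k * poch x (l + 2) 3 k = poch x l 1 (3 * k)"
proof (induction k)
  case (Suc k)
  have "poch x l 1 (3 * Suc k) = poch x l 1 (3 * k) * th x (l + 3 * int k) * th x (l + 1 + 3 * int k) * th x (l + 2 + 3 * int k)"
    by (simp add: poch_Suc algebra_simps numeral_3_eq_3)
  also have "poch x l 1 (3 * k) = poch x l 3 k * poch x (l + 1) 3 k * poch x (l + 2) 3 k" using Suc ..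
  finally show ?case by (simp add: poch_Suc mult_ac)
qed simp

theorem theorem4p8:
  fixes p q a b c d e :: complex and n :: nat
  assumes hp: "norm p < 1" and hq: "q \<noteq> 0"
    and hnz: "a \<noteq> 0" "b \<noteq> 0" "c \<noteq> 0" "d \<noteq> 0" "e \<noteq> 0"
    and hbc: "b * c = a ^ 2 * q ^ (n + 1)"
    and hde: "d * e = a * q ^ (n + 1)"
    and gen1: "ethe p a \<noteq> 0"
    and gen2: "\<forall>k \<le> n div 2.
                 tpochs q p [a * q / b, a * q / c] (int k) \<noteq> 0
               \<and> tpoch q p (a * q ^ (n + 1)) (int (2 * k)) \<noteq> 0
               \<and> tpochs (q ^ 3) p [a * q ^ 3 / d, a * q ^ 3 / e] (int k) \<noteq> 0"
    and gen3: "tpoch q p (a * q / b) (int n) \<noteq> 0"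
    and gen4: "tpoch (q ^ 3) p (a * q powi (2 - int n)) (int n) \<noteq> 0"
    and gen5: "ethe p (a ^ 2 / (d * e)) \<noteq> 0"
    and gen6: "\<forall>k \<le> n div 3.
                 tpochs (q ^ 3) p (q ^ 3 # map (\<lambda>x. a ^ 2 / (d * e) * q ^ 3 / x)
                   [b, c, a / d, a / e, q powi (2 - int n), q powi (1 - int n), q powi (- int n)])
                   (int k) \<noteq> 0"
  shows "(\<Sum>k = 0..n div 2.
            ethe p (a * q ^ (4 * k)) / ethe p a
          * tpochs (q ^ 3) p [b, c] (int k) / tpochs q p [a * q / b, a * q / c] (int k)
          * tpoch q p (q powi (- int n)) (int (2 * k)) / tpoch q p (a * q ^ (n + 1)) (int (2 * k))
          * tpochs q p [d, e] (int k) / tpochs (q ^ 3) p [a * q ^ 3 / d, a * q ^ 3 / e] (int k)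
          * q ^ k)
       = tpoch q p (a * q) (int n) * tpoch (q ^ 3) p (a * q powi (2 - int n) / b) (int n)
         / (tpoch q p (a * q / b) (int n) * tpoch (q ^ 3) p (a * q powi (2 - int n)) (int n))
         * omega (q ^ 3) p (a ^ 2 / (d * e))
             [b, c, a / d, a / e, q powi (2 - int n), q powi (1 - int n), q powi (- int n)]"
proof -
  interpret theta_base p q using hp hq by unfold_locales
  define Qn where "Qn = q ^ n"
  have Qn: "Qn \<noteq> 0" using hq by (simp add: Qn_def)
  have pw: "q powi (- int n - 1) = 1 / (Qn * q)" "q powi (2 - int n) = q\<^sup>2 / Qn" "q powi (1 - int n) = q / Qn"
      "q powi (- int n) = 1 / Qn" "q powi (int n + 1) = Qn * q" "q ^ (n + 1) = Qn * q"
    using hq by (simp_all add: Qn_def power_int_add power_int_diff power_int_minus divide_inverse)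
  define a1 where "a1 = a ^ 2 / (d * e)"
  have a1: "a1 = a * q powi (- int n - 1)"
    using hnz hq Qn unfolding a1_def hde pw by (simp add: field_simps power2_eq_square)
  have one: "tpoch q p (x * q powi l) (int k) = poch x l 1 k" for x l k
    using tpoch_eq_poch[of 1] by simp
  have three: "tpoch (q ^ 3) p (x * q powi l) (int k) = poch x l 3 k" for x l k
    using tpoch_eq_poch[of 3] by simp
  have p1: "tpoch q p x (int k) = poch x 0 1 k" for x k using one[of x 0] by simp
  have p3: "tpoch (q ^ 3) p x (int k) = poch x 0 3 k" for x k using three[of x 0] by simp
  have q1: "tpoch q p (a * q / x) (int k) = poch (a / x) 1 1 k" for x k using one[of "a / x" 1 k] by simp
  have q3: "tpoch (q ^ 3) p (a * q ^ 3 / x) (int k) = poch (a / x) 3 3 k" for x k using three[of "a / x" 3 k] by simp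
  have pn: "tpoch q p (a * q ^ (n + 1)) (int k) = poch a (int n + 1) 1 k" for k
    using one[of a "int n + 1" k] unfolding pw by simp
  have pm: "tpoch q p (q powi (- int n)) (int k) = poch 1 (- int n) 1 k" for k
    using one[of 1 "- int n" k] by simp
  have paq: "tpoch q p (a * q) (int k) = poch a 1 1 k" for k using one[of a 1 k] by simp
  have p2n: "tpoch (q ^ 3) p (a * q powi (2 - int n) / b) (int k) = poch (a / b) (2 - int n) 3 k" for k
    using three[of "a / b" "2 - int n" k] by simp
  have ps: "tpoch (q ^ 3) p (q powi l) (int k) = poch 1 l 3 k" for l k using three[of 1 l k] by simp
  have pq3: "tpoch (q ^ 3) p (q ^ 3) (int k) = poch 1 3 3 k" for k using three[of 1 3 k] by simp
  have pa1: "tpoch (q ^ 3) p a1 (int k) = poch a (- int n - 1) 3 k" for k unfolding a1 three ..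
  \<comment> \<open>The quotients for a/d and a/e are interchanged: the former gives a q^3/e, the
    latter a q^3/d.\<close>
  have den: "a1 * q ^ 3 / x = a / x * q powi (2 - int n)" "a1 * q ^ 3 / (a / d) = a / e * q powi 3" "a1 * q ^ 3 / (a / e) = a / d * q powi 3"
     "a1 * q ^ 3 / q powi (2 - int n) = a * q powi 0" "a1 * q ^ 3 / q powi (1 - int n) = a * q powi 1" "a1 * q ^ 3 / q powi (- int n) = a * q powi 2" for x
  proof -
    show "a1 * q ^ 3 / (a / d) = a / e * q powi 3" "a1 * q ^ 3 / (a / e) = a / d * q powi 3"
      using hnz by (simp_all add: a1_def field_simps power2_eq_square)
    show "a1 * q ^ 3 / x = a / x * q powi (2 - int n)" 
      "a1 * q ^ 3 / q powi (2 - int n) = a * q powi 0" "a1 * q ^ 3 / q powi (1 - int n) = a * q powi 1" "a1 * q ^ 3 / q powi (- int n) = a * q powi 2"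
      unfolding a1 pw using hq Qn by (simp_all add: field_simps power2_eq_square power3_eq_cube)
  qed
  have Pa3: "poch a 0 3 k * poch a 1 3 k * poch a 2 3 k = poch a 0 1 (3 * k)" for k using poch_triple[of a 0 k] by simp
  have Pn3: "poch 1 (2 - int n) 3 k * poch 1 (1 - int n) 3 k * poch 1 (- int n) 3 k = poch 1 (- int n) 1 (3 * k)" for k
    using poch_triple[of 1 "- int n" k] by (simp add: mult_ac)
  have dens: "tpochs (q ^ 3) p (q ^ 3 # map (\<lambda>x. a1 * q ^ 3 / x)
                   [b, c, a / d, a / e, q powi (2 - int n), q powi (1 - int n), q powi (- int n)]) (int k)
     = poch 1 3 3 k * (poch (a / b) (2 - int n) 3 k * poch (a / c) (2 - int n) 3 k) * (poch (a / d) 3 3 k * poch (a / e) 3 3 k) * poch a 0 1 (3 * k)" for k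
  proof -
    have "tpochs (q ^ 3) p (q ^ 3 # map (\<lambda>x. a1 * q ^ 3 / x)
                   [b, c, a / d, a / e, q powi (2 - int n), q powi (1 - int n), q powi (- int n)]) (int k)
      = poch 1 3 3 k * (poch (a / b) (2 - int n) 3 k * (poch (a / c) (2 - int n) 3 k * (poch (a / e) 3 3 k * (poch (a / d) 3 3 k * (poch a 0 3 k * (poch a 1 3 k * poch a 2 3 k))))))"
      unfolding tpochs_def list.map den(2-) unfolding den(1) three pq3
      by simp
    then show ?thesis unfolding Pa3[symmetric] by (simp only: mult_ac)
  qed
  have nums: "tpochs (q ^ 3) p (a1 # [b, c, a / d, a / e, q powi (2 - int n), q powi (1 - int n), q powi (- int n)]) (int k)
    = poch a (- int n - 1) 3 k * (poch b 0 3 k * poch c 0 3 k) * (poch (a / d) 0 3 k * poch (a / e) 0 3 k) * poch 1 (- int n) 1 (3 * k)" for k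
    unfolding tpochs_def Pn3[symmetric] list.map prod_list.Cons prod_list.Nil mult_1_right pa1 ps
    unfolding p3 by (simp only: mult_ac)
  have th0: "ethe p a1 = th a (- int n - 1)" "ethe p a = th a 0"
    by (simp_all add: th_def a1)
  have th6: "ethe p (a1 * (q ^ 3) ^ (2 * k)) = th a (6 * int k - int n - 1)" for k
  proof -
    have "6 * int k - int n - 1 = (- int n - 1) + int (3 * (2 * k))" by simp
    then have "q powi (6 * int k - int n - 1) = q powi (- int n - 1) * (q ^ 3) ^ (2 * k)"
      unfolding power_mult[symmetric] using hq by (simp only: power_int_add power_int_of_nat simp_thms)
    then show ?thesis by (simp add: th_def a1 mult_ac)
  qed
  have th4: "ethe p (a * q ^ (4 * k)) = th a (4 * int k)" for k
    using power_int_of_nat[of q "4 * k"] by (simp add: th_def)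
  have "omega (q ^ 3) p a1 [b, c, a / d, a / e, q powi (2 - int n), q powi (1 - int n), q powi (- int n)]
      = (\<Sum>k. omega_term n a b c d e k)"
    unfolding omega_def nums dens th6 th0 omega_term_def unfolding power_mult ..
  also have "\<dots> = (\<Sum>k\<le>n div 3. omega_term n a b c d e k)"
  \<comment> \<open>For n < 3k the merged numerator contains E(q^(-n) q^n) = E(1) = 0. This handles
    all residues of n modulo 3 at once, and such a term is 0 whatever its denominator.\<close>
  proof (rule suminf_finite)
    fix k assume "k \<notin> {..n div 3}"
    then have "n < 3 * k" by auto
    moreover have "th 1 (- int n + 1 * int n) = 0" using th_1_0 by simp
    ultimately have "poch 1 (- int n) 1 (3 * k) = 0" unfolding poch_def by (intro prod_zero bexI[of _ n]) simp_all
    then show "omega_term n a b c d e k = 0" by (simp add: omega_term_def)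
  qed simp
  finally have om: "omega (q ^ 3) p (a\<^sup>2 / (d * e)) [b, c, a / d, a / e, q powi (2 - int n), q powi (1 - int n), q powi (- int n)]
     = (\<Sum>k\<le>n div 3. omega_term n a b c d e k)" by (simp only: a1_def)
  have pre: "tpoch q p (a * q) (int n) * tpoch (q ^ 3) p (a * q powi (2 - int n) / b) (int n)
         / (tpoch q p (a * q / b) (int n) * tpoch (q ^ 3) p (a * q powi (2 - int n)) (int n)) = prefactor n a b"
    unfolding paq p2n q1 three prefactor_def ..
  have lhs: "(\<Sum>k = 0..n div 2.
            ethe p (a * q ^ (4 * k)) / ethe p a
          * tpochs (q ^ 3) p [b, c] (int k) / tpochs q p [a * q / b, a * q / c] (int k)
          * tpoch q p (q powi (- int n)) (int (2 * k)) / tpoch q p (a * q ^ (n + 1)) (int (2 * k))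
          * tpochs q p [d, e] (int k) / tpochs (q ^ 3) p [a * q ^ 3 / d, a * q ^ 3 / e] (int k)
          * q ^ k) = (\<Sum>k\<le>n div 2. lhs_term n a b c d e k)"
    unfolding atLeast0AtMost tpochs_def th4 th0 pn pm list.map prod_list.Cons prod_list.Nil mult_1_right q1 q3
    unfolding p3 p1 lhs_term_def outer_term_def
    by (simp add: mult_ac)
  have "(\<Sum>k\<le>n div 2. lhs_term n a b c d e k) = prefactor n a b * (\<Sum>j\<le>n div 3. omega_term n a b c d e j)"
  proof (rule transformation[OF hnz hbc hde])
    show "th a 0 \<noteq> 0" using gen1 by (simp add: th_def)
    show "poch (a / b) 1 1 n \<noteq> 0" "poch a (2 - int n) 3 n \<noteq> 0" "th a (- int n - 1) \<noteq> 0"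
      using gen3 gen4 gen5 by (simp_all add: q1 three flip: a1_def th0)
    fix k
    show "poch (a / b) 1 1 k \<noteq> 0 \<and> poch (a / c) 1 1 k \<noteq> 0 \<and> poch a (int n + 1) 1 (2 * k) \<noteq> 0 \<and> poch (a / d) 3 3 k \<noteq> 0 \<and> poch (a / e) 3 3 k \<noteq> 0"
      if "k \<le> n div 2"
      using gen2[rule_format, OF that] unfolding tpochs_def pn list.map prod_list.Cons prod_list.Nil q1 q3 by simp
    show "poch 1 3 3 k \<noteq> 0 \<and> poch (a / b) (2 - int n) 3 k \<noteq> 0 \<and> poch (a / c) (2 - int n) 3 k \<noteq> 0
       \<and> poch (a / d) 3 3 k \<noteq> 0 \<and> poch (a / e) 3 3 k \<noteq> 0 \<and> poch a 0 1 (3 * k) \<noteq> 0" if "k \<le> n div 3"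
      using gen6[rule_format, OF that] unfolding a1_def[symmetric] dens by simp
  qed
  then show ?thesis unfolding om pre lhs .
qed

end
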